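(* Let $e\ge 2$ be an integer, let $q=2^e$, and let $G=\mathrm{AGL}_1(q)$ be the group of affine transformations $t\mapsto at+b$ ($a,b\in\mathbb{F}_q$, $a\neq 0$) of the field $\mathbb{F}_q$. Let $\phi$ denote Euler's totient function. (a) If $e>2$ there are exactly $\phi(q-1)/e$ maps $\mathcal{M}\in\mathcal{O}(G)$, all of extended type $\{q-1,q-1\}_4$ and genus $(q-1)(q-4)/4$; they are all chiral, and satisfy $D(\mathcal{M})\cong H_{-1}(\mathcal{M})$ and $H_2(\mathcal{M})\cong\mathcal{M}$. (b) If $e=2$ there is a single map $\mathcal{M}\in\mathcal{O}(G)$, the tetrahedral map $\{3,3\}$ of genus $0$, which is outer regular with $\mathrm{Aut}\,\mathcal{M}\cong\mathrm{A\Gamma L}_1(4)\cong \mathrm{S}_4$. (c) For each $e\ge 2$ the graph $\mathcal{O}(G)$ is connected.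
   Context: An orientably regular map $\mathcal{M}$ with orientation-preserving automorphism group $\mathrm{Aut}^+\mathcal{M}\cong G$ ($G$ a finite group) is equivalent to a generating triple $(x,y,z)$ of $G$ with $y$ of order $2$ and $xyz=1$; here $x$ rotates arcs (directed edges) around their incident vertices following the orientation, $y$ reverses arcs, and $z$ rotates arcs around faces. Two maps are isomorphic if and only if their triples are equivalent under $\mathrm{Aut}\,G$. The triple is determined by the pair $(x,y)$. $\mathcal{O}(G)$ denotes the set of isomorphism classes of orientably regular maps $\mathcal{M}$ with $\mathrm{Aut}^+\mathcal{M}\cong G$. If $z$ has order $k$ and $x$ has order $l$, the map has type $\{k,l\}$ (faces are $k$-gons, vertices have valency $l$). It has $|G|/l$ vertices, $|G|/2$ edges and $|G|/k$ faces, and its genus $g$ is given by $2-2g=|G|/l-|G|/2+|G|/k$. Its Petrie length $r$ is twice the order of the commutator $[x,y]=x^{-1}y^{-1}xy$; the extended type is $\{k,l\}_r$. Duality $D$ replaces $(x,y,z)$ by $(z,y,(zy)^{-1})$. For $j$ coprime to the valency $l$, the hole operation $H_j$ replaces $(x,y,z)$ by $(x^j,y,(x^jy)^{-1})$. Both operations preserve $G$, so they act on maps in $\mathcal{O}(G)$. The set $\mathcal{O}(G)$ is regarded as the vertex set of a graph, also denoted $\mathcal{O}(G)$, in which each $\mathcal{M}$ is joined by edges to $D(\mathcal{M})$ and to $H_j(\mathcal{M})$ for all $j$ coprime to the valency of $\mathcal{M}$ (loops omitted; connectedness ignores edge directions). The map $\mathcal{M}$ is regular if there is an automorphism $\alpha$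 of $G$ inverting $x$ and $y$ (equivalently $H_{-1}(\mathcal{M})\cong\mathcal{M}$), and chiral otherwise. If $\mathcal{M}$ is regular, its full automorphism group is $\mathrm{Aut}\,\mathcal{M}\cong G\rtimes\langle\alpha\rangle$, a semidirect product of $G$ with $\mathrm{C}_2$; $\mathcal{M}$ is called inner regular or outer regular according to whether $\alpha$ is or is not an inner automorphism of $G$. $\mathrm{A\Gamma L}_1(q)=\mathrm{AGL}_1(q)\rtimes\mathrm{Gal}\,\mathbb{F}_q$, where $\mathrm{Gal}\,\mathbb{F}_q$ is the Galois group of $\mathbb{F}_q$ over its prime field. *)

theory Defs
  imports
    "HOL-Algebra.Algebra"
    "HOL-Number_Theory.Totient"
    "HOL-Combinatorics.Cycles"
    "Graph_Theory.Digraph_Component"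
begin

section \<open>Groups\<close>

text \<open>External semidirect product \<open>G \<rtimes> H\<close>, with \<open>h \<in> H\<close> acting on \<open>G\<close> as \<open>\<theta> h\<close>.\<close>

definition semidirect ::
  "('a, 'c) monoid_scheme \<Rightarrow> ('b, 'd) monoid_scheme \<Rightarrow> ('b \<Rightarrow> 'a \<Rightarrow> 'a) \<Rightarrow> ('a \<times> 'b) monoid"
  where "semidirect G H \<theta> =
    \<lparr>carrier = carrier G \<times> carrier H,
     monoid.mult = (\<lambda>(g, h) (g', h'). (g \<otimes>\<^bsub>G\<^esub> \<theta> h g', h \<otimes>\<^bsub>H\<^esub> h')),
     one = (\<one>\<^bsub>G\<^esub>, \<one>\<^bsub>H\<^esub>)\<rparr>"

definition inner_auto :: "('a, 'c) monoid_scheme \<Rightarrow> ('a \<Rightarrow> 'a) set"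
  where "inner_auto G = {\<lambda>h\<in>carrier G. g \<otimes>\<^bsub>G\<^esub> h \<otimes>\<^bsub>G\<^esub> inv\<^bsub>G\<^esub> g | g. g \<in> carrier G}"

definition AGL1 :: "('a, 'b) ring_scheme \<Rightarrow> ('a \<Rightarrow> 'a) monoid"
  where "AGL1 R = BijGroup (carrier R)
    \<lparr>carrier := {\<lambda>t\<in>carrier R. a \<otimes>\<^bsub>R\<^esub> t \<oplus>\<^bsub>R\<^esub> b | a b.
                   a \<in> carrier R - {\<zero>\<^bsub>R\<^esub>} \<and> b \<in> carrier R}\<rparr>"

definition prime_subfield :: "('a, 'b) ring_scheme \<Rightarrow> 'a set"
  where "prime_subfield R = \<Inter>{K. subfield K R}"

definition Gal_prime :: "('a, 'b) ring_scheme \<Rightarrow> ('a \<Rightarrow> 'a) monoid"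
  where "Gal_prime R = BijGroup (carrier R)
    \<lparr>carrier := {\<sigma> \<in> Bij (carrier R). \<sigma> \<in> ring_hom R R \<and> (\<forall>k\<in>prime_subfield R. \<sigma> k = k)}\<rparr>"

text \<open>A Galois automorphism \<open>\<sigma>\<close> acts on affine maps by conjugation in the symmetric group of
  the field: \<open>t \<mapsto> a t + b\<close> is sent to \<open>t \<mapsto> (\<sigma> a) t + \<sigma> b\<close>.\<close>

definition AGammaL1 :: "('a, 'b) ring_scheme \<Rightarrow> (('a \<Rightarrow> 'a) \<times> ('a \<Rightarrow> 'a)) monoid"
  where "AGammaL1 R = semidirect (AGL1 R) (Gal_prime R)
    (\<lambda>\<sigma> g. \<sigma> \<otimes>\<^bsub>BijGroup (carrier R)\<^esub> g \<otimes>\<^bsub>BijGroup (carrier R)\<^esub> inv\<^bsub>BijGroup (carrier R)\<^esub> \<sigma>)"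


section \<open>Orientably regular maps as generating triples\<close>

text \<open>An orientably regular map with orientation-preserving automorphism group \<open>G\<close> is given by
  a generating triple \<open>(x, y, z)\<close> of \<open>G\<close>, and its isomorphism class by the orbit of that triple
  under \<open>Aut G\<close>.  The automorphisms in \<^const>\<open>auto\<close> are extensional functions.\<close>

type_synonym 'a triple = "'a \<times> 'a \<times> 'a"

definition map_triples :: "('a, 'c) monoid_scheme \<Rightarrow> 'a triple set"
  where "map_triples G = {(x, y, z).
    x \<in> carrier G \<and> y \<in> carrier G \<and> z \<in> carrier G \<and> generate G {x, y, z} = carrier G \<and>
    group.ord G y = 2 \<and> x \<otimes>\<^bsub>G\<^esub> y \<otimes>\<^bsub>G\<^esub> z = \<one>\<^bsub>G\<^esub>}"

definition apply_triple :: "('a \<Rightarrow> 'b) \<Rightarrow> 'a triple \<Rightarrow> 'b triple"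
  where "apply_triple f = (\<lambda>(x, y, z). (f x, f y, f z))"

definition map_equiv :: "('a, 'c) monoid_scheme \<Rightarrow> 'a triple rel"
  where "map_equiv G =
    {(s, t). s \<in> map_triples G \<and> t \<in> map_triples G \<and> (\<exists>\<alpha>\<in>auto G. t = apply_triple \<alpha> s)}"

definition ormaps :: "('a, 'c) monoid_scheme \<Rightarrow> 'a triple set set"
  where "ormaps G = map_triples G // map_equiv G"

definition valency :: "('a, 'c) monoid_scheme \<Rightarrow> 'a triple \<Rightarrow> nat"
  where "valency G = (\<lambda>(x, y, z). group.ord G x)"

definition face_size :: "('a, 'c) monoid_scheme \<Rightarrow> 'a triple \<Rightarrow> nat"
  where "face_size G = (\<lambda>(x, y, z). group.ord G z)"

definition petrie_length :: "('a, 'c) monoid_scheme \<Rightarrow> 'a triple \<Rightarrow> nat"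
  where "petrie_length G =
    (\<lambda>(x, y, z). 2 * group.ord G (inv\<^bsub>G\<^esub> x \<otimes>\<^bsub>G\<^esub> inv\<^bsub>G\<^esub> y \<otimes>\<^bsub>G\<^esub> x \<otimes>\<^bsub>G\<^esub> y))"

text \<open>\<open>(k, l, r)\<close> stands for the extended type \<open>{k, l}\<^sub>r\<close>.\<close>

definition extended_type :: "('a, 'c) monoid_scheme \<Rightarrow> 'a triple \<Rightarrow> nat \<times> nat \<times> nat"
  where "extended_type G t = (face_size G t, valency G t, petrie_length G t)"

text \<open>The solution \<open>g\<close> of \<open>2 - 2g = |G|/l - |G|/2 + |G|/k\<close>.\<close>

definition genus :: "('a, 'c) monoid_scheme \<Rightarrow> 'a triple \<Rightarrow> real"
  where "genus G t =
    1 - (real (order G) / real (valency G t) - real (order G) / 2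
         + real (order G) / real (face_size G t)) / 2"

definition inverting_autos :: "('a, 'c) monoid_scheme \<Rightarrow> 'a triple \<Rightarrow> ('a \<Rightarrow> 'a) set"
  where "inverting_autos G = (\<lambda>(x, y, z). {\<alpha> \<in> auto G. \<alpha> x = inv\<^bsub>G\<^esub> x \<and> \<alpha> y = inv\<^bsub>G\<^esub> y})"

definition regular_map :: "('a, 'c) monoid_scheme \<Rightarrow> 'a triple \<Rightarrow> bool"
  where "regular_map G t \<longleftrightarrow> (\<exists>\<alpha>. \<alpha> \<in> inverting_autos G t)"

definition chiral :: "('a, 'c) monoid_scheme \<Rightarrow> 'a triple \<Rightarrow> bool"
  where "chiral G t \<longleftrightarrow> \<not> regular_map G t"

text \<open>Since \<open>x\<close> and \<open>y\<close> generate \<open>G\<close>, there is at most one inverting automorphism.\<close>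

definition outer_regular :: "('a, 'c) monoid_scheme \<Rightarrow> 'a triple \<Rightarrow> bool"
  where "outer_regular G t \<longleftrightarrow> (\<exists>\<alpha>\<in>inverting_autos G t. \<alpha> \<notin> inner_auto G)"


section \<open>The full automorphism group\<close>

text \<open>\<open>G\<close> acts regularly on the arcs, so arcs are identified with elements \<open>g\<close> of \<open>G\<close>: automorphisms
  act by left multiplication, while rotating an arc around its initial vertex and reversing it are
  right multiplication by \<open>x\<close> and by \<open>y\<close>.  A flag is an arc together with one of its two sides
  (\<open>True\<close>: left).  The three functions below send a flag to the flag that differs from it exactly in
  the vertex, in the edge, and in the face, respectively.  The full automorphism group consists of
  the permutations of the flags that commute with these three functions; it includes the
  orientation-reversing automorphisms.\<close>

definition flags :: "('a, 'c) monoid_scheme \<Rightarrow> ('a \<times> bool) set"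
  where "flags G = carrier G \<times> UNIV"

definition flag_vertex :: "('a, 'c) monoid_scheme \<Rightarrow> 'a triple \<Rightarrow> 'a \<times> bool \<Rightarrow> 'a \<times> bool"
  where "flag_vertex G = (\<lambda>(x, y, z) (g, s). (g \<otimes>\<^bsub>G\<^esub> y, \<not> s))"

definition flag_edge :: "('a, 'c) monoid_scheme \<Rightarrow> 'a triple \<Rightarrow> 'a \<times> bool \<Rightarrow> 'a \<times> bool"
  where "flag_edge G =
    (\<lambda>(x, y, z) (g, s). (if s then g \<otimes>\<^bsub>G\<^esub> x else g \<otimes>\<^bsub>G\<^esub> inv\<^bsub>G\<^esub> x, \<not> s))"

definition flag_face :: "'a \<times> bool \<Rightarrow> 'a \<times> bool"
  where "flag_face = (\<lambda>(g, s). (g, \<not> s))"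

definition full_aut :: "('a, 'c) monoid_scheme \<Rightarrow> 'a triple \<Rightarrow> ('a \<times> bool \<Rightarrow> 'a \<times> bool) monoid"
  where "full_aut G t = BijGroup (flags G)
    \<lparr>carrier := {f \<in> Bij (flags G). \<forall>p\<in>flags G.
       f (flag_vertex G t p) = flag_vertex G t (f p) \<and>
       f (flag_edge G t p) = flag_edge G t (f p) \<and>
       f (flag_face p) = flag_face (f p)}\<rparr>"


section \<open>Map operations and the graph they define\<close>

definition dual :: "('a, 'c) monoid_scheme \<Rightarrow> 'a triple \<Rightarrow> 'a triple"
  where "dual G = (\<lambda>(x, y, z). (z, y, inv\<^bsub>G\<^esub> (z \<otimes>\<^bsub>G\<^esub> y)))"

definition hole :: "('a, 'c) monoid_scheme \<Rightarrow> int \<Rightarrow> 'a triple \<Rightarrow> 'a triple"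
  where "hole G j = (\<lambda>(x, y, z). (x [^]\<^bsub>G\<^esub> j, y, inv\<^bsub>G\<^esub> (x [^]\<^bsub>G\<^esub> j \<otimes>\<^bsub>G\<^esub> y)))"

text \<open>On isomorphism classes the operations act by taking images: they commute with \<open>Aut G\<close>, so
  the image of the class of \<open>t\<close> is the whole class of the image of \<open>t\<close>.\<close>

definition ormaps_graph :: "('a, 'c) monoid_scheme \<Rightarrow> 'a triple set pair_pre_digraph"
  where "ormaps_graph G =
    \<lparr>pverts = ormaps G,
     parcs = {(M, N). M \<in> ormaps G \<and> N \<noteq> M \<and>
       (N = dual G ` M \<or>
        (\<exists>j. (\<forall>t\<in>M. coprime j (int (valency G t))) \<and> N = hole G j ` M))}\<rparr>"


section \<open>The tetrahedral map\<close>

text \<open>The rotation group of the tetrahedron with vertices 1, 2, 3, 4 is \<open>A\<^sub>4\<close>.  With respect to the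
  arc from 1 to 2, \<open>x\<close> rotates around the vertex 1, and \<open>y\<close> is the half-turn reversing the arc.\<close>

definition tetrahedral_triple :: "(nat \<Rightarrow> nat) triple"
  where "tetrahedral_triple =
    (let x = cycle_of_list [2, 3, 4]; y = transpose 1 2 \<circ> transpose 3 4
     in (x, y, inv\<^bsub>alt_group 4\<^esub> (x \<circ> y)))"

end

theory Submission
  imports Defs
begin

text \<open>
  A triple \<open>(x, y, z)\<close> generates \<open>AGL\<^sub>1(q)\<close> with \<open>y\<close> an involution exactly when \<open>y\<close> is a nontrivial
  translation and the linear part \<open>a\<close> of \<open>x\<close> is a primitive element of the field.  Conjugation by
  semilinear maps \<open>t \<mapsto> u t\<^sup>\<sigma> + v\<close> makes any two triples equivalent whose linear parts are conjugate
  under the Frobenius map.  Conversely, an automorphism of the group is additive on the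
  translations, so it sends \<open>a\<close> to an element that satisfies the same polynomial equations over the
  prime field; since \<open>a\<close> satisfies one of degree at most \<open>e\<close>, its \<open>e\<close> distinct Frobenius conjugates are
  all the roots.  Thus the maps correspond to the orbits of the Frobenius map, all of length \<open>e\<close>, on
  the \<open>\<phi>(q - 1)\<close> primitive elements.  On this parameter \<open>H\<^sub>j\<close> acts as \<open>a \<mapsto> a\<^sup>j\<close> and \<open>D\<close> as inversion,
  and regularity of the map means that \<open>a\<^sup>-\<^sup>1\<close> is a Frobenius conjugate of \<open>a\<close>, which forces \<open>e = 2\<close>.
\<close>

section \<open>The one-dimensional affine group of a field\<close>

text \<open>Why only the linear part a of \<open>x\<close> survives as an invariant: a differs from
  1, so \<open>x\<close> has a unique fixed point p, and the pair (\<open>x\<close>,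
  \<open>y\<close>) is determined by a, p and the vector b of the translation \<open>y\<close>. The
  affine maps t -> u t + v carry any p and any nonzero b to any others, so conjugation leaves a as
  the sole datum. The obstacle is the converse, since an abstract automorphism is not known to be
  semilinear. A relation over the prime field that holds for a is a vanishing sum of distinct powers
  of a, and this form survives any additive map that intertwines multiplication by a with
  multiplication by its image. No minimal polynomial is constructed: counting subset sums already
  gives a relation of degree at most e. For e = 2 the full automorphism group is found by embedding
  the group as the even permutations of the four field elements: a transposition inverts both
  generators, so the flags become the elements of S4. The same four points identify the affine
  semilinear group with S4 by an order count.\<close>

hide_const (open) Ring_Divisibility.mult_of

definition aff :: "('a, 'b) ring_scheme \<Rightarrow> 'a \<Rightarrow> 'a \<Rightarrow> 'a \<Rightarrow> 'a"
  where "aff R a b = (\<lambda>t\<in>carrier R. a \<otimes>\<^bsub>R\<^esub> t \<oplus>\<^bsub>R\<^esub> b)"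

text \<open>Slope of an affine map, read off from its values at 1 and 0. Elements of the group are
  bare functions, so the coefficient has to be recovered from values.\<close>

definition lin :: "('a, 'b) ring_scheme \<Rightarrow> ('a \<Rightarrow> 'a) \<Rightarrow> 'a"
  where "lin R g = g \<one>\<^bsub>R\<^esub> \<ominus>\<^bsub>R\<^esub> g \<zero>\<^bsub>R\<^esub>"

context field
begin

lemma inv_nonzero:
  assumes "a \<in> carrier R" "a \<noteq> \<zero>"
  shows "inv a \<in> carrier R" "inv a \<otimes> a = \<one>" "a \<otimes> inv a = \<one>" "inv a \<noteq> \<zero>"
proof -
  have "a \<in> Units R" using assms by (simp add: field_Units)
  then show "inv a \<in> carrier R" "inv a \<otimes> a = \<one>" "a \<otimes> inv a = \<one>" by simp_all
  then show "inv a \<noteq> \<zero>" using assms by force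
qed

lemma lin_aff [simp]:
  assumes "a \<in> carrier R" "b \<in> carrier R"
  shows "lin R (aff R a b) = a"
  using assms by (simp add: lin_def aff_def a_minus_def a_assoc r_neg)

lemma aff_zero [simp]: "a \<in> carrier R \<Longrightarrow> b \<in> carrier R \<Longrightarrow> aff R a b \<zero> = b"
  by (simp add: aff_def)

lemma aff_eq_iff:
  assumes "a \<in> carrier R" "b \<in> carrier R" "c \<in> carrier R" "d \<in> carrier R"
  shows "aff R a b = aff R c d \<longleftrightarrow> a = c \<and> b = d"
  using assms by (metis lin_aff aff_zero)

lemma compose_aff:
  assumes "a \<in> carrier R" "b \<in> carrier R" "c \<in> carrier R" "d \<in> carrier R"
  shows "compose (carrier R) (aff R a b) (aff R c d) = aff R (a \<otimes> c) (a \<otimes> d \<oplus> b)"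
  using assms by (auto simp: aff_def compose_def restrict_def fun_eq_iff) algebra

lemma aff_one_zero: "aff R \<one> \<zero> = (\<lambda>t\<in>carrier R. t)"
  by (auto simp: aff_def)

lemma aff_Bij:
  assumes a: "a \<in> carrier R - {\<zero>}" and b: "b \<in> carrier R"
  shows "aff R a b \<in> Bij (carrier R)"
proof -
  have "inv a \<in> carrier R" and ia: "inv a \<otimes> a = \<one>" "a \<otimes> inv a = \<one>"
    using a by (simp_all add: inv_nonzero)
  then have inv: "inv a \<in> carrier R" "\<ominus> (inv a \<otimes> b) \<in> carrier R" using b by auto
  have "bij_betw (aff R a b) (carrier R) (carrier R)"
  proof (rule bij_betw_byWitness[where f' = "aff R (inv a) (\<ominus> (inv a \<otimes> b))"])
    have "compose (carrier R) (aff R (inv a) (\<ominus> (inv a \<otimes> b))) (aff R a b) = aff R \<one> \<zero>"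
      using a b inv ia by (simp add: compose_aff r_neg)
    then show "\<forall>t\<in>carrier R. aff R (inv a) (\<ominus> (inv a \<otimes> b)) (aff R a b t) = t"
      by (metis aff_one_zero compose_eq restrict_apply')
    have "a \<otimes> (\<ominus> (inv a \<otimes> b)) \<oplus> b = \<zero>"
      using a b inv ia by (metis DiffD1 l_neg l_one m_assoc r_minus \<open>inv a \<in> carrier R\<close> m_closed)
    then have "compose (carrier R) (aff R a b) (aff R (inv a) (\<ominus> (inv a \<otimes> b))) = aff R \<one> \<zero>"
      using a b inv ia by (simp add: compose_aff)
    then show "\<forall>t\<in>carrier R. aff R a b (aff R (inv a) (\<ominus> (inv a \<otimes> b)) t) = t"
      by (metis aff_one_zero compose_eq restrict_apply')
  qed (use a b inv in \<open>auto simp: aff_def\<close>)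
  then show ?thesis by (simp add: Bij_def aff_def)
qed

lemma carrier_AGL1: "carrier (AGL1 R) = (\<lambda>(a, b). aff R a b) ` ((carrier R - {\<zero>}) \<times> carrier R)"
  by (force simp: AGL1_def aff_def image_iff)

lemma aff_in_AGL1 [simp, intro]:
  "a \<in> carrier R \<Longrightarrow> a \<noteq> \<zero> \<Longrightarrow> b \<in> carrier R \<Longrightarrow> aff R a b \<in> carrier (AGL1 R)"
  by (auto simp: carrier_AGL1)

lemma AGL1_cases [elim]:
  assumes "g \<in> carrier (AGL1 R)"
  obtains a b where "a \<in> carrier R" "a \<noteq> \<zero>" "b \<in> carrier R" "g = aff R a b"
  using assms by (auto simp: carrier_AGL1)

lemma AGL1_eq: "AGL1 R = BijGroup (carrier R)\<lparr>carrier := carrier (AGL1 R)\<rparr>"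
  by (simp add: AGL1_def)

lemma aff_mult [simp]:
  assumes "a \<in> carrier R" "a \<noteq> \<zero>" "b \<in> carrier R" "c \<in> carrier R" "c \<noteq> \<zero>" "d \<in> carrier R"
  shows "aff R a b \<otimes>\<^bsub>AGL1 R\<^esub> aff R c d = aff R (a \<otimes> c) (a \<otimes> d \<oplus> b)"
  using assms aff_Bij by (simp add: AGL1_def BijGroup_def compose_aff)

lemma AGL1_one: "\<one>\<^bsub>AGL1 R\<^esub> = aff R \<one> \<zero>"
  by (simp add: AGL1_def BijGroup_def aff_one_zero)

lemma AGL1_group: "group (AGL1 R)"
proof (rule groupI)
  fix f g assume "f \<in> carrier (AGL1 R)" "g \<in> carrier (AGL1 R)"
  then show "f \<otimes>\<^bsub>AGL1 R\<^esub> g \<in> carrier (AGL1 R)"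
    by (auto simp: integral_iff elim!: AGL1_cases)
next
  fix f g h assume "f \<in> carrier (AGL1 R)" "g \<in> carrier (AGL1 R)" "h \<in> carrier (AGL1 R)"
  then show "f \<otimes>\<^bsub>AGL1 R\<^esub> g \<otimes>\<^bsub>AGL1 R\<^esub> h = f \<otimes>\<^bsub>AGL1 R\<^esub> (g \<otimes>\<^bsub>AGL1 R\<^esub> h)"
    by (auto simp: integral_iff r_distr m_assoc a_assoc elim!: AGL1_cases)
next
  fix f assume "f \<in> carrier (AGL1 R)"
  then obtain a b where a: "a \<in> carrier R" "a \<noteq> \<zero>" "b \<in> carrier R" "f = aff R a b" ..
  then have i: "inv a \<in> carrier R" "inv a \<otimes> a = \<one>" "inv a \<noteq> \<zero>"
    by (simp_all add: inv_nonzero)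
  show "\<exists>g\<in>carrier (AGL1 R). g \<otimes>\<^bsub>AGL1 R\<^esub> f = \<one>\<^bsub>AGL1 R\<^esub>"
    using a i by (intro bexI[where x = "aff R (inv a) (\<ominus> (inv a \<otimes> b))"])
      (auto simp: AGL1_one r_neg)
qed (auto simp: AGL1_one elim!: AGL1_cases)

lemma AGL1_subgroup: "subgroup (carrier (AGL1 R)) (BijGroup (carrier R))"
proof -
  interpret B: group "BijGroup (carrier R)" by (rule group_BijGroup)
  show ?thesis
  proof (rule B.group_incl_imp_subgroup)
    show "carrier (AGL1 R) \<subseteq> carrier (BijGroup (carrier R))"
      using aff_Bij by (auto simp: BijGroup_def elim!: AGL1_cases)
    show "group (BijGroup (carrier R)\<lparr>carrier := carrier (AGL1 R)\<rparr>)"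
      using AGL1_group AGL1_eq by simp
  qed
qed

lemma lin_closed [simp, intro]: "g \<in> carrier (AGL1 R) \<Longrightarrow> lin R g \<in> carrier R"
  and lin_nonzero [simp]: "g \<in> carrier (AGL1 R) \<Longrightarrow> lin R g \<noteq> \<zero>"
  by (auto elim!: AGL1_cases)

lemma lin_mult [simp]:
  "g \<in> carrier (AGL1 R) \<Longrightarrow> h \<in> carrier (AGL1 R) \<Longrightarrow>
    lin R (g \<otimes>\<^bsub>AGL1 R\<^esub> h) = lin R g \<otimes> lin R h"
  by (auto simp: elim!: AGL1_cases)

lemma lin_hom: "lin R \<in> hom (AGL1 R) (mult_of R)"
  by (auto simp: hom_def)

lemma lin_group_hom: "group_hom (AGL1 R) (mult_of R) (lin R)"
  using AGL1_group field_mult_group lin_hom by (simp add: group_hom_def group_hom_axioms_def)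

lemma lin_inv [simp]: "g \<in> carrier (AGL1 R) \<Longrightarrow> lin R (inv\<^bsub>AGL1 R\<^esub> g) = inv (lin R g)"
  using group_hom.hom_inv[OF lin_group_hom, of g] by (simp add: m_inv_mult_of)

lemma lin_pow [simp]:
  "g \<in> carrier (AGL1 R) \<Longrightarrow> lin R (g [^]\<^bsub>AGL1 R\<^esub> (n::nat)) = lin R g [^] n"
  using group_hom.hom_nat_pow[OF lin_group_hom, of g n] by (simp add: Multiplicative_Group.nat_pow_mult_of)

lemma lin_one [simp]: "lin R \<one>\<^bsub>AGL1 R\<^esub> = \<one>"
  by (simp add: AGL1_one)

lemma lin_eq_oneD:
  assumes "g \<in> carrier (AGL1 R)" "lin R g = \<one>"
  obtains b where "b \<in> carrier R" "g = aff R \<one> b"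
  using assms by (auto elim!: AGL1_cases)

text \<open>A power of \<open>g\<close> that is a translation commutes with \<open>g\<close>, so it is trivial.\<close>

lemma ord_aff:
  assumes g: "g \<in> carrier (AGL1 R)" and l: "lin R g \<noteq> \<one>"
  shows "group.ord (AGL1 R) g = group.ord (mult_of R) (lin R g)"
proof -
  interpret G: group "AGL1 R" by (rule AGL1_group)
  interpret M: group "mult_of R" by (rule field_mult_group)
  obtain a c where a: "a \<in> carrier R" "a \<noteq> \<zero>" "c \<in> carrier R" "g = aff R a c"
    using g ..
  have "g [^]\<^bsub>AGL1 R\<^esub> n = \<one>\<^bsub>AGL1 R\<^esub> \<longleftrightarrow> lin R g [^] n = \<one>" for n :: nat
  proof
    assume "lin R g [^] n = \<one>"
    then have "lin R (g [^]\<^bsub>AGL1 R\<^esub> n) = \<one>" using g by simp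
    then obtain d where d: "d \<in> carrier R" "g [^]\<^bsub>AGL1 R\<^esub> n = aff R \<one> d"
      using g lin_eq_oneD[of "g [^]\<^bsub>AGL1 R\<^esub> n"] by blast
    have "g \<otimes>\<^bsub>AGL1 R\<^esub> aff R \<one> d = aff R \<one> d \<otimes>\<^bsub>AGL1 R\<^esub> g"
      using d G.nat_pow_Suc G.nat_pow_Suc2 g by metis
    then have "a \<otimes> d \<oplus> c = c \<oplus> d" using a d by (simp add: aff_eq_iff)
    then have "a \<otimes> d = \<one> \<otimes> d" using a d by (simp add: a_comm)
    then have "d = \<zero>" using a d l by (metis lin_aff m_rcancel one_closed)
    then show "g [^]\<^bsub>AGL1 R\<^esub> n = \<one>\<^bsub>AGL1 R\<^esub>" using d by (simp add: AGL1_one)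
  qed (use g in \<open>metis lin_pow lin_one\<close>)
  then show ?thesis
    using g M.pow_eq_id[of "lin R g"]
    by (subst G.ord_unique) (auto simp flip: Multiplicative_Group.nat_pow_mult_of)
qed

end

section \<open>Equivalence of generating triples\<close>

lemma apply_triple_simp [simp]: "apply_triple f (x, y, z) = (f x, f y, f z)"
  by (simp add: apply_triple_def)

context group
begin

lemma map_triples_in_carrier:
  "(x, y, z) \<in> map_triples G \<Longrightarrow> x \<in> carrier G \<and> y \<in> carrier G \<and> z \<in> carrier G"
  by (simp add: map_triples_def)

lemma auto_group_hom: "\<alpha> \<in> auto G \<Longrightarrow> group_hom G G \<alpha>"
  by unfold_locales (simp add: auto_def)

lemma auto_inj: "\<alpha> \<in> auto G \<Longrightarrow> inj_on \<alpha> (carrier G)"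
  by (simp add: auto_def Bij_def bij_betw_def)

lemma auto_surj: "\<alpha> \<in> auto G \<Longrightarrow> \<alpha> ` carrier G = carrier G"
  by (simp add: auto_def Bij_def bij_betw_def)

lemma auto_ord:
  assumes \<alpha>: "\<alpha> \<in> auto G" and x: "x \<in> carrier G"
  shows "ord (\<alpha> x) = ord x"
proof -
  interpret A: group_hom G G \<alpha> using \<alpha> by (rule auto_group_hom)
  have "\<alpha> x [^] n = \<one> \<longleftrightarrow> x [^] n = \<one>" for n :: nat
    using auto_inj[OF \<alpha>] x A.hom_nat_pow[OF x, of n]
    by (metis A.hom_one inj_onD nat_pow_closed one_closed)
  then show ?thesis using x by (subst ord_unique) (auto simp: pow_eq_id)
qed

lemma apply_triple_map_triples:
  assumes \<alpha>: "\<alpha> \<in> auto G" and t: "t \<in> map_triples G"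
  shows "apply_triple \<alpha> t \<in> map_triples G"
proof -
  obtain x y z where xyz: "t = (x, y, z)" by (cases t)
  interpret A: group_hom G G \<alpha> using \<alpha> by (rule auto_group_hom)
  have c: "x \<in> carrier G" "y \<in> carrier G" "z \<in> carrier G" "generate G {x, y, z} = carrier G"
    "ord y = 2" "x \<otimes> y \<otimes> z = \<one>"
    using t by (auto simp: map_triples_def xyz)
  have "generate G {\<alpha> x, \<alpha> y, \<alpha> z} = carrier G"
    using A.generate_img[of "{x, y, z}"] c auto_surj[OF \<alpha>] by simp
  moreover have "\<alpha> x \<otimes> \<alpha> y \<otimes> \<alpha> z = \<one>"
    using c by (simp flip: A.hom_mult)
  ultimately show ?thesis
    using c auto_ord[OF \<alpha>] by (simp add: xyz map_triples_def)
qed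

text \<open>All three laws come down to \<open>auto G\<close> being a subgroup of
  \<open>BijGroup (carrier G)\<close>. The default values of extensional functions never show,
  because triples lie in the carrier.\<close>

lemma map_equiv_equiv: "equiv (map_triples G) (map_equiv G)"
proof (rule equivI)
  interpret B: subgroup "auto G" "BijGroup (carrier G)" by (rule subgroup_auto)
  show "map_equiv G \<subseteq> map_triples G \<times> map_triples G" by (auto simp: map_equiv_def)
  show "refl_on (map_triples G) (map_equiv G)"
  proof (rule refl_onI)
    fix t assume t: "t \<in> map_triples G"
    then have "t = apply_triple (\<lambda>x\<in>carrier G. x) t"
      by (cases t) (auto dest: map_triples_in_carrier)
    with t id_in_auto show "(t, t) \<in> map_equiv G" unfolding map_equiv_def by blast
  qed
  show "sym (map_equiv G)"
  proof (rule symI)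
    fix s t assume "(s, t) \<in> map_equiv G"
    then obtain \<alpha> where st: "s \<in> map_triples G" "t \<in> map_triples G" "\<alpha> \<in> auto G" "t = apply_triple \<alpha> s"
      by (auto simp: map_equiv_def)
    let ?\<beta> = "inv\<^bsub>BijGroup (carrier G)\<^esub> \<alpha>"
    have "\<alpha> \<in> Bij (carrier G)" using st by (simp add: auto_def)
    then have "?\<beta> (\<alpha> x) = x" if "x \<in> carrier G" for x
      using that st auto_inj[of \<alpha>] auto_surj[of \<alpha>] by (auto simp: inv_BijGroup)
    then have "s = apply_triple ?\<beta> t"
      using st by (cases s) (auto dest: map_triples_in_carrier)
    moreover have "?\<beta> \<in> auto G" using st B.m_inv_closed by blast
    ultimately show "(t, s) \<in> map_equiv G" using st by (auto simp: map_equiv_def)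
  qed
  show "trans (map_equiv G)"
  proof (rule transI)
    fix s t u assume "(s, t) \<in> map_equiv G" "(t, u) \<in> map_equiv G"
    then obtain \<alpha> \<beta> where st: "s \<in> map_triples G" "u \<in> map_triples G"
      "\<alpha> \<in> auto G" "t = apply_triple \<alpha> s" "\<beta> \<in> auto G" "u = apply_triple \<beta> t"
      by (auto simp: map_equiv_def)
    have "\<alpha> \<in> Bij (carrier G)" "\<beta> \<in> Bij (carrier G)" using st by (auto simp: auto_def)
    then have c: "\<beta> \<otimes>\<^bsub>BijGroup (carrier G)\<^esub> \<alpha> = compose (carrier G) \<beta> \<alpha>"
      by (simp add: BijGroup_def)
    have "compose (carrier G) \<beta> \<alpha> \<in> auto G" using B.m_closed[OF st(5,3)] c by simp
    moreover have "u = apply_triple (compose (carrier G) \<beta> \<alpha>) s"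
      using st by (cases s) (auto simp: compose_eq dest: map_triples_in_carrier)
    ultimately show "(s, u) \<in> map_equiv G" using st unfolding map_equiv_def by blast
  qed
qed

text \<open>A class is the orbit of any of its triples under \<open>auto G\<close>, and
  \<open>F\<close> commutes with that action. This is what justifies letting duality and the hole
  operations act on classes by images.\<close>

lemma map_equiv_class_image:
  assumes F: "\<And>t. t \<in> map_triples G \<Longrightarrow> F t \<in> map_triples G"
    and equivariant: "\<And>\<alpha> t. \<alpha> \<in> auto G \<Longrightarrow> t \<in> map_triples G \<Longrightarrow> F (apply_triple \<alpha> t) = apply_triple \<alpha> (F t)"
    and t: "t \<in> map_triples G"
  shows "F ` (map_equiv G `` {t}) = map_equiv G `` {F t}"
proof -
  have cls: "map_equiv G `` {s} = (\<lambda>\<alpha>. apply_triple \<alpha> s) ` auto G" if "s \<in> map_triples G" for s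
    using that apply_triple_map_triples[OF _ that] unfolding map_equiv_def by blast
  show ?thesis using t F[OF t] by (force simp: cls equivariant image_image)
qed

lemma dual_equivariant:
  assumes "\<alpha> \<in> auto G" "t \<in> map_triples G"
  shows "dual G (apply_triple \<alpha> t) = apply_triple \<alpha> (dual G t)"
proof -
  interpret A: group_hom G G \<alpha> using assms(1) by (rule auto_group_hom)
  show ?thesis using assms by (cases t) (auto simp: dual_def dest!: map_triples_in_carrier)
qed

lemma hole_equivariant:
  assumes "\<alpha> \<in> auto G" "t \<in> map_triples G"
  shows "hole G j (apply_triple \<alpha> t) = apply_triple \<alpha> (hole G j t)"
proof -
  interpret A: group_hom G G \<alpha> using assms(1) by (rule auto_group_hom)
  show ?thesis using assms by (cases t) (auto simp: hole_def A.hom_int_pow dest!: map_triples_in_carrier)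
qed

end

section \<open>Permutation groups and full automorphism groups\<close>

lemma iso_sym_if_closed:
  assumes h: "h \<in> iso M H"
    and M: "\<And>u v. u \<in> carrier M \<Longrightarrow> v \<in> carrier M \<Longrightarrow> u \<otimes>\<^bsub>M\<^esub> v \<in> carrier M"
    and H: "\<And>u v. u \<in> carrier H \<Longrightarrow> v \<in> carrier H \<Longrightarrow> u \<otimes>\<^bsub>H\<^esub> v \<in> carrier H"
  shows "H \<cong> M"
proof (rule is_isoI[OF isoI])
  let ?k = "inv_into (carrier M) h"
  have hom: "h \<in> hom M H" and bij: "bij_betw h (carrier M) (carrier H)"
    using h by (auto simp: iso_def)
  show k: "bij_betw ?k (carrier H) (carrier M)" using bij by (rule bij_betw_inv_into)
  have hk: "h (?k u) = u" if "u \<in> carrier H" for u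
    using that bij by (simp add: bij_betw_inv_into_right)
  have k_in: "?k u \<in> carrier M" if "u \<in> carrier H" for u
    using that k by (rule bij_betw_apply[rotated])
  show "?k \<in> hom H M"
  proof (rule homI)
    fix u v assume uv: "u \<in> carrier H" "v \<in> carrier H"
    have "h (?k (u \<otimes>\<^bsub>H\<^esub> v)) = h (?k u \<otimes>\<^bsub>M\<^esub> ?k v)"
      using uv hom_mult[OF hom k_in[OF uv(1)] k_in[OF uv(2)]] by (simp add: hk H)
    then show "?k (u \<otimes>\<^bsub>H\<^esub> v) = ?k u \<otimes>\<^bsub>M\<^esub> ?k v"
      using uv k_in M H bij by (metis bij_betw_inv_into_left)
  qed (rule k_in)
qed

text \<open>Transport of a permutation along the labelling \<beta>. Outside 1..n it is the identity,
  as \<open>sym_group\<close> demands, whereas elements of \<open>BijGroup\<close> are undefined off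
  their set.\<close>

definition relabel :: "nat \<Rightarrow> (nat \<Rightarrow> 'a) \<Rightarrow> ('a \<Rightarrow> 'a) \<Rightarrow> nat \<Rightarrow> nat"
  where "relabel n \<beta> f = (\<lambda>i. if i \<in> {1..n} then inv_into {1..n} \<beta> (f (\<beta> i)) else i)"

lemma relabel_apply:
  assumes "bij_betw \<beta> {1..n} S" "f \<in> S \<rightarrow> S" "i \<in> {1..n}"
  shows "relabel n \<beta> f i \<in> {1..n}" "\<beta> (relabel n \<beta> f i) = f (\<beta> i)"
proof -
  have "f (\<beta> i) \<in> S" using assms bij_betwE by blast
  then have "f (\<beta> i) \<in> \<beta> ` {1..n}" using assms by (simp add: bij_betw_def)
  then show "relabel n \<beta> f i \<in> {1..n}" "\<beta> (relabel n \<beta> f i) = f (\<beta> i)"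
    using assms(3) inv_into_into[of "f (\<beta> i)" \<beta> "{1..n}"]
    by (auto simp: relabel_def f_inv_into_f)
qed

text \<open>Recognises a transported permutation by the intertwining relation alone, so that
  \<open>inv_into\<close> never has to be evaluated.\<close>

lemma relabel_eqI:
  assumes \<beta>: "bij_betw \<beta> {1..n} S" and p: "p permutes {1..n}"
    and f: "\<And>i. i \<in> {1..n} \<Longrightarrow> f (\<beta> i) = \<beta> (p i)"
  shows "relabel n \<beta> f = p"
proof
  fix i show "relabel n \<beta> f i = p i"
  proof (cases "i \<in> {1..n}")
    case True
    then have "p i \<in> {1..n}" using p by (simp only: permutes_in_image)
    then show ?thesis
      using True f \<beta> unfolding relabel_def by (simp add: bij_betw_def inv_into_f_f)
  qed (use p in \<open>auto simp: relabel_def permutes_not_in\<close>)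
qed

lemma relabel_iso:
  assumes \<beta>: "bij_betw \<beta> {1..n} S"
  shows "relabel n \<beta> \<in> iso (BijGroup S) (sym_group n)"
proof (rule isoI)
  have inj: "inj_on \<beta> {1..n}" using \<beta> by (simp add: bij_betw_def)
  have perm: "relabel n \<beta> f permutes {1..n}" if f: "f \<in> Bij S" for f
  proof (rule bij_imp_permutes)
    have fS: "f \<in> S \<rightarrow> S" "inj_on f S" using f by (auto simp: Bij_def bij_betw_def)
    have "inj_on (relabel n \<beta> f) {1..n}"
    proof (rule inj_onI)
      fix i j assume ij: "i \<in> {1..n}" "j \<in> {1..n}" "relabel n \<beta> f i = relabel n \<beta> f j"
      then have "f (\<beta> i) = f (\<beta> j)" using relabel_apply(2)[OF \<beta> fS(1)] by metis
      moreover have "\<beta> i \<in> S" "\<beta> j \<in> S" using ij \<beta> bij_betwE by blast+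
      ultimately show "i = j" using fS(2) inj ij by (metis inj_onD)
    qed
    moreover have "relabel n \<beta> f ` {1..n} \<subseteq> {1..n}"
      using relabel_apply(1)[OF \<beta> fS(1)] by blast
    ultimately show "bij_betw (relabel n \<beta> f) {1..n} {1..n}"
      by (simp add: bij_betw_def endo_inj_surj)
  qed (auto simp: relabel_def)
  show "relabel n \<beta> \<in> hom (BijGroup S) (sym_group n)"
  proof (rule homI)
    fix f g assume "f \<in> carrier (BijGroup S)" "g \<in> carrier (BijGroup S)"
    then have fg: "f \<in> Bij S" "g \<in> Bij S" by (simp_all add: BijGroup_def)
    show "relabel n \<beta> (f \<otimes>\<^bsub>BijGroup S\<^esub> g) = relabel n \<beta> f \<otimes>\<^bsub>sym_group n\<^esub> relabel n \<beta> g"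
      unfolding sym_group_mult
    proof (rule relabel_eqI[OF \<beta>])
      show "relabel n \<beta> f \<circ> relabel n \<beta> g permutes {1..n}"
        using perm fg by (intro permutes_compose) auto
      fix i assume i: "i \<in> {1..n}"
      have "f \<in> S \<rightarrow> S" "g \<in> S \<rightarrow> S" "\<beta> i \<in> S"
        using Bij_imp_funcset[OF fg(1)] Bij_imp_funcset[OF fg(2)] bij_betw_apply[OF \<beta> i] .
      then show "(f \<otimes>\<^bsub>BijGroup S\<^esub> g) (\<beta> i) = \<beta> ((relabel n \<beta> f \<circ> relabel n \<beta> g) i)"
        using fg i relabel_apply[OF \<beta>] by (simp add: BijGroup_def compose_eq)
    qed
  qed (use perm in \<open>auto simp: BijGroup_def sym_group_carrier\<close>)
  have "p \<in> relabel n \<beta> ` Bij S" if p: "p permutes {1..n}" for p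
  proof -
    let ?f = "\<lambda>x\<in>S. \<beta> (p (inv_into {1..n} \<beta> x))"
    have "bij_betw (\<beta> \<circ> p \<circ> inv_into {1..n} \<beta>) S S"
      using bij_betw_inv_into[OF \<beta>] permutes_imp_bij[OF p] \<beta> by (blast intro: bij_betw_trans)
    then have "bij_betw ?f S S" by (rule bij_betw_cong[THEN iffD1, rotated]) auto
    then have "?f \<in> Bij S" by (simp add: Bij_def)
    moreover have "relabel n \<beta> ?f = p"
      using \<beta> inj bij_betwE[OF \<beta>] by (intro relabel_eqI[OF \<beta> p]) simp
    ultimately show ?thesis by (metis image_eqI)
  qed
  moreover have "inj_on (relabel n \<beta>) (Bij S)"
  proof (rule inj_onI)
    fix f g assume fg: "f \<in> Bij S" "g \<in> Bij S" "relabel n \<beta> f = relabel n \<beta> g"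
    show "f = g"
    proof (rule extensionalityI[of _ S])
      fix x assume "x \<in> S"
      then obtain i where "i \<in> {1..n}" "x = \<beta> i" using \<beta> by (auto simp: bij_betw_def)
      then show "f x = g x"
        using relabel_apply(2)[OF \<beta>] fg by (metis Bij_imp_funcset)
    qed (use fg in \<open>auto dest: Bij_imp_extensional\<close>)
  qed
  ultimately show "bij_betw (relabel n \<beta>) (carrier (BijGroup S)) (carrier (sym_group n))"
    using perm by (auto simp: bij_betw_def BijGroup_def sym_group_carrier)
qed

text \<open>Reading the flag \<open>(g, True)\<close> as \<open>h g\<close> and the flag \<open>(g, False)\<close> as \<open>h g \<otimes> \<tau>\<close> identifies the
  flags with the elements of \<open>H\<close>, and the three flag operations with the right multiplications by
  the reflections \<open>h y \<otimes> \<tau>\<close>, \<open>h x \<otimes> \<tau>\<close> and \<open>\<tau>\<close>, which generate \<open>H\<close>.\<close>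

lemma full_aut_is_iso:
  assumes G: "group G" and H: "group H" and K: "subgroup K H"
    and h: "h \<in> iso G (H\<lparr>carrier := K\<rparr>)" and t: "(x, y, z) \<in> map_triples G"
    and \<tau>: "\<tau> \<in> carrier H" "\<tau> \<notin> K" "\<tau> \<otimes>\<^bsub>H\<^esub> \<tau> = \<one>\<^bsub>H\<^esub>"
    and index: "\<And>u. u \<in> carrier H \<Longrightarrow> u \<notin> K \<Longrightarrow> u \<otimes>\<^bsub>H\<^esub> \<tau> \<in> K"
    and refl: "\<tau> \<otimes>\<^bsub>H\<^esub> h x \<otimes>\<^bsub>H\<^esub> \<tau> = inv\<^bsub>H\<^esub> h x" "\<tau> \<otimes>\<^bsub>H\<^esub> h y \<otimes>\<^bsub>H\<^esub> \<tau> = inv\<^bsub>H\<^esub> h y"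
  shows "H \<cong> full_aut G (x, y, z)"
proof -
  interpret G: group G by fact
  interpret H: group H by fact
  interpret K: subgroup K H by fact
  have hK: "h ` carrier G = K" "inj_on h (carrier G)"
    and "h \<in> hom G H" using h K.subset by (auto simp: iso_def hom_def bij_betw_def)
  then interpret h: group_hom G H h by unfold_locales simp
  have xyz: "x \<in> carrier G" "y \<in> carrier G" "z \<in> carrier G" "generate G {x, y, z} = carrier G"
    "G.ord y = 2" "x \<otimes>\<^bsub>G\<^esub> y \<otimes>\<^bsub>G\<^esub> z = \<one>\<^bsub>G\<^esub>"
    using t by (auto simp: map_triples_def)
  have hKI: "h g \<in> K" if "g \<in> carrier G" for g using that hK by blast
  have "y [^]\<^bsub>G\<^esub> (2::nat) = \<one>\<^bsub>G\<^esub>" using xyz(2,5) G.pow_ord_eq_1 by metis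
  then have "y \<otimes>\<^bsub>G\<^esub> y = \<one>\<^bsub>G\<^esub>" using xyz(2) by (simp add: numeral_2_eq_2)
  then have inv_y: "inv\<^bsub>G\<^esub> y = y" using xyz(2) by (simp add: G.inv_equality)
  let ?F = "flags G"
  define \<phi> where "\<phi> p = (if snd p then h (fst p) else h (fst p) \<otimes>\<^bsub>H\<^esub> \<tau>)" for p :: "_ \<times> bool"
  have \<tau>_cancel [simp]: "u \<otimes>\<^bsub>H\<^esub> \<tau> \<otimes>\<^bsub>H\<^esub> \<tau> = u" if "u \<in> carrier H" for u
    using that \<tau> by (simp add: H.m_assoc)
  \<comment> \<open>With \<open>index\<close>, this splits \<open>H\<close> into the two cosets
    \<open>K\<close> and \<open>K \<tau>\<close>, which correspond to the two sides of an
    arc.\<close>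
  have \<tau>_notin: "u \<otimes>\<^bsub>H\<^esub> \<tau> \<notin> K" if "u \<in> K" for u
  proof
    assume "u \<otimes>\<^bsub>H\<^esub> \<tau> \<in> K"
    then have "inv\<^bsub>H\<^esub> u \<otimes>\<^bsub>H\<^esub> (u \<otimes>\<^bsub>H\<^esub> \<tau>) \<in> K" using that by simp
    moreover have "inv\<^bsub>H\<^esub> u \<otimes>\<^bsub>H\<^esub> (u \<otimes>\<^bsub>H\<^esub> \<tau>) = \<tau>" using that \<tau>(1) by (simp flip: H.m_assoc)
    ultimately show False using \<tau> by simp
  qed
  have \<phi>_bij: "bij_betw \<phi> ?F (carrier H)"
    unfolding bij_betw_def
  proof
    show "inj_on \<phi> ?F"
    proof (rule inj_onI)
      fix p q assume pq: "p \<in> ?F" "q \<in> ?F" "\<phi> p = \<phi> q"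
      then have c: "fst p \<in> carrier G" "fst q \<in> carrier G" by (auto simp: flags_def)
      have s: "snd p = snd q"
        using pq(3) \<tau>_notin[OF hKI[OF c(1)]] \<tau>_notin[OF hKI[OF c(2)]] hKI[OF c(1)] hKI[OF c(2)]
        by (auto simp: \<phi>_def split: if_splits)
      then have "h (fst p) = h (fst q)"
        using pq(3) c \<tau>(1) by (auto simp: \<phi>_def split: if_splits)
      then show "p = q" using s c hK(2) by (simp add: prod_eq_iff inj_onD)
    qed
    show "\<phi> ` ?F = carrier H"
    proof
      show "carrier H \<subseteq> \<phi> ` ?F"
      proof
        fix u assume u: "u \<in> carrier H"
        show "u \<in> \<phi> ` ?F"
        proof (cases "u \<in> K")
          case True
          then obtain g where "g \<in> carrier G" "u = h g" using hK by blast
          then have "(g, True) \<in> ?F" "u = \<phi> (g, True)" by (auto simp: flags_def \<phi>_def)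
          then show ?thesis by blast
        next
          case False
          then obtain g where "g \<in> carrier G" "u \<otimes>\<^bsub>H\<^esub> \<tau> = h g" using hK index u by blast
          then have "(g, False) \<in> ?F" "u = \<phi> (g, False)"
            using \<tau>_cancel[OF u] by (auto simp: flags_def \<phi>_def)
          then show ?thesis by blast
        qed
      qed
    qed (use \<tau>(1) in \<open>auto simp: flags_def \<phi>_def\<close>)
  qed
  define \<psi> where "\<psi> = inv_into ?F \<phi>"
  have \<psi>_bij: "bij_betw \<psi> (carrier H) ?F" unfolding \<psi>_def by (rule bij_betw_inv_into[OF \<phi>_bij])
  have \<phi>\<psi> [simp]: "\<phi> (\<psi> u) = u" if "u \<in> carrier H" for u
    using that \<phi>_bij unfolding \<psi>_def by (simp add: bij_betw_def f_inv_into_f)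
  have \<psi>\<phi> [simp]: "\<psi> (\<phi> p) = p" if "p \<in> ?F" for p
    using that \<phi>_bij unfolding \<psi>_def by (simp add: bij_betw_def)
  have \<psi>_in [simp]: "\<psi> u \<in> ?F" if "u \<in> carrier H" for u using that \<psi>_bij bij_betwE by blast
  have \<phi>_in [simp]: "\<phi> p \<in> carrier H" if "p \<in> ?F" for p using that \<phi>_bij bij_betwE by blast
  define rv where "rv = h y \<otimes>\<^bsub>H\<^esub> \<tau>"
  define re where "re = h x \<otimes>\<^bsub>H\<^esub> \<tau>"
  have r_in: "rv \<in> carrier H" "re \<in> carrier H" using xyz \<tau>(1) by (auto simp: rv_def re_def)
  \<comment> \<open>Moving a factor past a trailing \<tau> conjugates it by \<tau>, which
    \<open>refl\<close> turns into inversion. This accounts for the inverse of \<open>x\<close> in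
    \<open>flag_edge\<close> on the \<open>False\<close> side.\<close>
  have conj: "u \<otimes>\<^bsub>H\<^esub> \<tau> \<otimes>\<^bsub>H\<^esub> (v \<otimes>\<^bsub>H\<^esub> \<tau>) = u \<otimes>\<^bsub>H\<^esub> (\<tau> \<otimes>\<^bsub>H\<^esub> v \<otimes>\<^bsub>H\<^esub> \<tau>)"
    if "u \<in> carrier H" "v \<in> carrier H" for u v
    using that \<tau>(1) by (simp add: H.m_assoc)
  have ops: "flag_vertex G (x, y, z) p \<in> ?F" "flag_edge G (x, y, z) p \<in> ?F" "flag_face p \<in> ?F"
    "\<phi> (flag_vertex G (x, y, z) p) = \<phi> p \<otimes>\<^bsub>H\<^esub> rv"
    "\<phi> (flag_edge G (x, y, z) p) = \<phi> p \<otimes>\<^bsub>H\<^esub> re"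
    "\<phi> (flag_face p) = \<phi> p \<otimes>\<^bsub>H\<^esub> \<tau>" if p: "p \<in> ?F" for p
  proof -
    obtain g s where g: "p = (g, s)" "g \<in> carrier G" using p by (auto simp: flags_def)
    show "flag_vertex G (x, y, z) p \<in> ?F" "flag_edge G (x, y, z) p \<in> ?F" "flag_face p \<in> ?F"
      using g xyz by (auto simp: flags_def flag_vertex_def flag_edge_def flag_face_def)
    have hy: "\<tau> \<otimes>\<^bsub>H\<^esub> h y \<otimes>\<^bsub>H\<^esub> \<tau> = h y" using refl(2) inv_y h.hom_inv[OF xyz(2)] by simp
    show "\<phi> (flag_vertex G (x, y, z) p) = \<phi> p \<otimes>\<^bsub>H\<^esub> rv"
      using g xyz \<tau>(1) conj[of "h g" "h y"] hy
      by (cases s) (simp_all add: \<phi>_def flag_vertex_def rv_def H.m_assoc)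
    show "\<phi> (flag_edge G (x, y, z) p) = \<phi> p \<otimes>\<^bsub>H\<^esub> re"
      using g xyz \<tau>(1) conj[of "h g" "h x"] refl(1)
      by (cases s) (simp_all add: \<phi>_def flag_edge_def re_def H.m_assoc)
    show "\<phi> (flag_face p) = \<phi> p \<otimes>\<^bsub>H\<^esub> \<tau>"
      using g \<tau>(1) by (cases s) (simp_all add: \<phi>_def flag_face_def)
  qed
  have \<phi>_inj: "p = q" if "p \<in> ?F" "q \<in> ?F" "\<phi> p = \<phi> q" for p q
    using that \<psi>\<phi> by metis
  \<comment> \<open>\<open>L u\<close> is left multiplication by \<open>u\<close> carried over to
    the flags. It commutes with the flag operations because these are right multiplications.\<close>
  define L where "L u = (\<lambda>p\<in>?F. \<psi> (u \<otimes>\<^bsub>H\<^esub> \<phi> p))" for u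
  have L_in: "L u p \<in> ?F" and \<phi>L: "\<phi> (L u p) = u \<otimes>\<^bsub>H\<^esub> \<phi> p"
    if "u \<in> carrier H" "p \<in> ?F" for u p
    using that by (auto simp: L_def)
  let ?A = "full_aut G (x, y, z)"
  have L_Bij: "L u \<in> Bij ?F" if u: "u \<in> carrier H" for u
  proof -
    have "bij_betw (L u) ?F ?F"
    proof (rule bij_betw_byWitness[where f' = "L (inv\<^bsub>H\<^esub> u)"])
      show "\<forall>p\<in>?F. L (inv\<^bsub>H\<^esub> u) (L u p) = p"
      proof
        fix p assume p: "p \<in> ?F"
        have "\<phi> (L (inv\<^bsub>H\<^esub> u) (L u p)) = \<phi> p"
          using u p L_in by (simp add: \<phi>L flip: H.m_assoc)
        then show "L (inv\<^bsub>H\<^esub> u) (L u p) = p" using u p L_in by (intro \<phi>_inj) auto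
      qed
      show "\<forall>p\<in>?F. L u (L (inv\<^bsub>H\<^esub> u) p) = p"
      proof
        fix p assume p: "p \<in> ?F"
        have "\<phi> (L u (L (inv\<^bsub>H\<^esub> u) p)) = \<phi> p"
          using u p L_in by (simp add: \<phi>L flip: H.m_assoc)
        then show "L u (L (inv\<^bsub>H\<^esub> u) p) = p" using u p L_in by (intro \<phi>_inj) auto
      qed
    qed (use u L_in in auto)
    then show ?thesis by (simp add: Bij_def L_def)
  qed
  have L_A: "L u \<in> carrier ?A" if u: "u \<in> carrier H" for u
  proof -
    have "L u (\<rho> p) = \<rho> (L u p)"
      if "\<And>p. p \<in> ?F \<Longrightarrow> \<rho> p \<in> ?F" "\<And>p. p \<in> ?F \<Longrightarrow> \<phi> (\<rho> p) = \<phi> p \<otimes>\<^bsub>H\<^esub> r" "p \<in> ?F" "r \<in> carrier H" for \<rho> r p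
      using that u L_in by (intro \<phi>_inj) (auto simp: \<phi>L H.m_assoc)
    then show ?thesis
      using L_Bij[OF u] ops r_in \<tau>(1) by (simp add: full_aut_def)
  qed
  have A_mult: "f \<otimes>\<^bsub>?A\<^esub> f' = compose ?F f f'" if "f \<in> Bij ?F" "f' \<in> Bij ?F" for f f'
    using that by (simp add: full_aut_def BijGroup_def)
  have "L \<in> hom H ?A"
  proof (rule homI)
    fix u v assume uv: "u \<in> carrier H" "v \<in> carrier H"
    show "L (u \<otimes>\<^bsub>H\<^esub> v) = L u \<otimes>\<^bsub>?A\<^esub> L v"
      unfolding A_mult[OF L_Bij[OF uv(1)] L_Bij[OF uv(2)]]
    proof (rule extensionalityI[of _ ?F])
      fix p assume p: "p \<in> ?F"
      show "L (u \<otimes>\<^bsub>H\<^esub> v) p = compose ?F (L u) (L v) p"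
        using uv p L_in by (intro \<phi>_inj) (auto simp: \<phi>L compose_eq H.m_assoc)
    qed (auto simp: L_def)
  qed (rule L_A)
  moreover have "bij_betw L (carrier H) (carrier ?A)"
    unfolding bij_betw_def
  proof
    let ?p = "\<psi> \<one>\<^bsub>H\<^esub>"
    show "inj_on L (carrier H)"
    proof (rule inj_onI)
      fix u v assume uv: "u \<in> carrier H" "v \<in> carrier H" "L u = L v"
      then have "\<phi> (L u ?p) = \<phi> (L v ?p)" by simp
      then show "u = v" using uv(1,2) by (simp add: \<phi>L)
    qed
    show "L ` carrier H = carrier ?A"
    proof
      show "carrier ?A \<subseteq> L ` carrier H"
      proof
        fix f assume "f \<in> carrier ?A"
        then have f: "f \<in> Bij ?F" and comm: "\<And>p. p \<in> ?F \<Longrightarrow>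
          f (flag_vertex G (x, y, z) p) = flag_vertex G (x, y, z) (f p) \<and>
          f (flag_edge G (x, y, z) p) = flag_edge G (x, y, z) (f p) \<and>
          f (flag_face p) = flag_face (f p)"
          by (auto simp: full_aut_def)
        have f_in: "f p \<in> ?F" if "p \<in> ?F" for p using that f Bij_imp_funcset by blast
        define E where "E u = \<phi> (f (\<psi> u))" for u
        have E_in: "E u \<in> carrier H" if "u \<in> carrier H" for u using that f_in by (simp add: E_def)
        \<comment> \<open>\<open>E\<close> is \<open>f\<close> read on \<open>H\<close>, and
          \<open>W\<close> collects the right multiplications that commute with it. \<open>W\<close>
          is a subgroup containing the three reflections, hence all of \<open>H\<close>; then E(u) =
          E(1) u, so \<open>f\<close> is a left multiplication.\<close>
        define W where "W = {w \<in> carrier H. \<forall>u\<in>carrier H. E (u \<otimes>\<^bsub>H\<^esub> w) = E u \<otimes>\<^bsub>H\<^esub> w}"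
        have gen: "r \<in> W" if r: "r \<in> carrier H" and \<rho>: "\<And>p. p \<in> ?F \<Longrightarrow> \<rho> p \<in> ?F"
          "\<And>p. p \<in> ?F \<Longrightarrow> \<phi> (\<rho> p) = \<phi> p \<otimes>\<^bsub>H\<^esub> r" "\<And>p. p \<in> ?F \<Longrightarrow> f (\<rho> p) = \<rho> (f p)" for \<rho> r
        proof -
          have "E (u \<otimes>\<^bsub>H\<^esub> r) = E u \<otimes>\<^bsub>H\<^esub> r" if u: "u \<in> carrier H" for u
          proof -
            have "\<psi> (u \<otimes>\<^bsub>H\<^esub> r) = \<rho> (\<psi> u)"
              using u r \<rho>(1,2) by (intro \<phi>_inj) auto
            then show ?thesis using u \<rho>(2,3) f_in by (simp add: E_def)
          qed
          then show ?thesis using r by (simp add: W_def)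
        qed
        have W3: "rv \<in> W" "re \<in> W" "\<tau> \<in> W"
          using gen[of rv "flag_vertex G (x, y, z)"] gen[of re "flag_edge G (x, y, z)"]
            gen[of \<tau> flag_face] r_in \<tau>(1) ops comm by auto
        have W_sub: "subgroup W H"
        proof (rule H.subgroupI)
          have "\<one>\<^bsub>H\<^esub> \<in> W" using E_in by (auto simp: W_def)
          then show "W \<noteq> {}" by blast
          fix w assume w: "w \<in> W"
          have "E (u \<otimes>\<^bsub>H\<^esub> inv\<^bsub>H\<^esub> w) = E u \<otimes>\<^bsub>H\<^esub> inv\<^bsub>H\<^esub> w" if u: "u \<in> carrier H" for u
          proof -
            have "E (u \<otimes>\<^bsub>H\<^esub> inv\<^bsub>H\<^esub> w \<otimes>\<^bsub>H\<^esub> w) = E (u \<otimes>\<^bsub>H\<^esub> inv\<^bsub>H\<^esub> w) \<otimes>\<^bsub>H\<^esub> w"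
              using w u unfolding W_def by blast
            then have "E u = E (u \<otimes>\<^bsub>H\<^esub> inv\<^bsub>H\<^esub> w) \<otimes>\<^bsub>H\<^esub> w"
              using w u by (simp add: W_def H.m_assoc)
            then show ?thesis using w u E_in by (simp add: W_def H.m_assoc)
          qed
          then show "inv\<^bsub>H\<^esub> w \<in> W" using w by (simp add: W_def)
          fix v assume v: "v \<in> W"
          have "E (u \<otimes>\<^bsub>H\<^esub> (w \<otimes>\<^bsub>H\<^esub> v)) = E u \<otimes>\<^bsub>H\<^esub> (w \<otimes>\<^bsub>H\<^esub> v)" if "u \<in> carrier H" for u
            using that v w E_in by (simp add: W_def flip: H.m_assoc)
          then show "w \<otimes>\<^bsub>H\<^esub> v \<in> W" using v w by (simp add: W_def)
        qed (auto simp: W_def)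
        then interpret W: subgroup W H .
        have hxy: "h x \<in> W" "h y \<in> W"
          using W.m_closed[OF W3(2,3)] W.m_closed[OF W3(1,3)] xyz by (simp_all add: rv_def re_def)
        have "h x \<otimes>\<^bsub>H\<^esub> h y \<otimes>\<^bsub>H\<^esub> h z = \<one>\<^bsub>H\<^esub>" using xyz by (simp flip: h.hom_mult)
        then have "h z = inv\<^bsub>H\<^esub> (h x \<otimes>\<^bsub>H\<^esub> h y)"
          using xyz by (metis G.m_closed H.inv_comm H.inv_equality H.m_closed h.hom_closed)
        then have "{h x, h y, h z} \<subseteq> W" using hxy by simp
        then have "generate H {h x, h y, h z} \<subseteq> W" by (rule H.generate_subgroup_incl[OF _ W_sub])
        moreover have "generate H {h x, h y, h z} = K"
          using h.generate_img[of "{x, y, z}"] xyz hK by simp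
        ultimately have KW: "K \<subseteq> W" by simp
        have HW: "u \<in> W" if u: "u \<in> carrier H" for u
        proof (cases "u \<in> K")
          case False
          then have "u \<otimes>\<^bsub>H\<^esub> \<tau> \<otimes>\<^bsub>H\<^esub> \<tau> \<in> W" using u index KW W3(3) by blast
          then show ?thesis using u by simp
        qed (use KW in blast)
        have "f = L (E \<one>\<^bsub>H\<^esub>)"
        proof (rule extensionalityI[of _ ?F])
          fix p assume p: "p \<in> ?F"
          have "\<phi> p \<in> W" using p HW by simp
          then have "E (\<one>\<^bsub>H\<^esub> \<otimes>\<^bsub>H\<^esub> \<phi> p) = E \<one>\<^bsub>H\<^esub> \<otimes>\<^bsub>H\<^esub> \<phi> p" unfolding W_def by blast
          then have "\<phi> (f p) = \<phi> (L (E \<one>\<^bsub>H\<^esub>) p)"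
            using p E_in[of "\<one>\<^bsub>H\<^esub>"] by (simp add: \<phi>L) (simp add: E_def)
          then show "f p = L (E \<one>\<^bsub>H\<^esub>) p" using p f_in L_in E_in by (intro \<phi>_inj) auto
        qed (use f Bij_imp_extensional in \<open>auto simp: L_def\<close>)
        then show "f \<in> L ` carrier H" using E_in by blast
      qed
    qed (use L_A in blast)
  qed
  ultimately have "L \<in> iso H ?A" by (simp add: iso_def)
  then show ?thesis by (auto simp: is_iso_def)
qed

section \<open>Finite fields of characteristic two\<close>

lemma card_primitive_elements:
  fixes R (structure)
  assumes "field R" "finite (carrier R)"
  shows "card {a \<in> carrier R - {\<zero>\<^bsub>R\<^esub>}. group.ord (mult_of R) a = card (carrier R) - 1}
    = totient (card (carrier R) - 1)" and
    "{a \<in> carrier R - {\<zero>\<^bsub>R\<^esub>}. group.ord (mult_of R) a = card (carrier R) - 1} \<noteq> {}"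
proof -
  interpret field R by fact
  interpret M: group "mult_of R" by (rule field_mult_group)
  have ord: "order (mult_of R) = card (carrier R) - 1"
    using assms(2) by (simp add: order_mult_of order_def)
  obtain a where a: "a \<in> carrier (mult_of R)" "carrier (mult_of R) = {a [^] i | i::nat. i \<in> UNIV}"
    using finite_field_mult_group_has_gen[OF assms(2)] by blast
  have "generate (mult_of R) {a} = carrier (mult_of R)"
    using M.generate_pow_on_finite_carrier[of a] a assms(2)
    by (simp add: Multiplicative_Group.nat_pow_mult_of)
  then have *: "M.ord a = card (carrier R) - 1"
    using M.generate_pow_card[OF a(1)] ord by (simp add: order_def)
  then show "{a \<in> carrier R - {\<zero>}. M.ord a = card (carrier R) - 1} \<noteq> {}"
    using a by auto
  \<comment> \<open>The count of elements of a given order is phrased with \<open>phi'\<close>; it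
    counts the same residues as \<open>totient\<close>.\<close>
  have "{x::nat. 1 \<le> x \<and> x \<le> n \<and> coprime x n} = totatives n" for n
    by (auto simp: totatives_def)
  then have "phi' n = totient n" for n
    by (simp add: phi'_def totient_def)
  then show "card {a \<in> carrier R - {\<zero>}. M.ord a = card (carrier R) - 1}
    = totient (card (carrier R) - 1)"
    using num_elems_of_ord_eq_phi'[OF assms(2), of "card (carrier R) - 1"] ord a(1) * by auto
qed

definition primitive :: "('a, 'b) ring_scheme \<Rightarrow> 'a set" where
  "primitive R = {a \<in> carrier R - {\<zero>\<^bsub>R\<^esub>}. group.ord (mult_of R) a = card (carrier R) - 1}"

text \<open>Conjugation of an affine map by the semilinear map \<open>t \<mapsto> u s(t) + v\<close>.\<close>

definition semi_conj ::
    "('a, 'b) ring_scheme \<Rightarrow> ('a \<Rightarrow> 'a) \<Rightarrow> 'a \<Rightarrow> 'a \<Rightarrow> ('a \<Rightarrow> 'a) \<Rightarrow> 'a \<Rightarrow> 'a"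
  where "semi_conj R s u v = (\<lambda>g\<in>carrier (AGL1 R).
    aff R (s (lin R g)) (u \<otimes>\<^bsub>R\<^esub> s (g \<zero>\<^bsub>R\<^esub>) \<oplus>\<^bsub>R\<^esub> (v \<ominus>\<^bsub>R\<^esub> s (lin R g) \<otimes>\<^bsub>R\<^esub> v)))"

locale binary_field = field +
  fixes e :: nat
  assumes card_carrier: "card (carrier R) = 2 ^ e" and e_ge_2: "e \<ge> 2"
begin

abbreviation "G \<equiv> AGL1 R"

section \<open>Characteristic two and the Frobenius map\<close>

lemma finite_carrier [simp, intro]: "finite (carrier R)"
  using card_carrier card.infinite by fastforce

text \<open>The characteristic comes from the order alone. By Lagrange in the additive group, 2^e
  times 1 is 0; this multiple equals (1 + 1)^e, and a field has no nonzero nilpotent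
  elements.\<close>

lemma add_self [simp]:
  assumes "a \<in> carrier R" shows "a \<oplus> a = \<zero>"
proof -
  have A: "group (add_monoid R)" by (rule a_group)
  have "\<one> [^]\<^bsub>add_monoid R\<^esub> order (add_monoid R) = \<one>\<^bsub>add_monoid R\<^esub>"
    by (rule group.pow_order_eq_1[OF A]) simp
  then have z: "add_pow R ((2::nat) ^ e) \<one> = \<zero>"
    by (simp add: order_def card_carrier add_pow_def)
  have *: "add_pow R ((2::nat) ^ n) \<one> = (add_pow R (2::nat) \<one>) [^] n" for n
  proof (induction n)
    case (Suc n)
    have "add_pow R ((2::nat) ^ Suc n) \<one> = add_pow R ((2::nat)^n * 2) (\<one> \<otimes> \<one>)" by (simp add: mult.commute)
    also have "\<dots> = add_pow R ((2::nat)^n) \<one> \<otimes> add_pow R (2::nat) \<one>"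
      by (simp add: add_pow_ldistr add_pow_rdistr add.nat_pow_pow mult.commute del: r_one l_one)
    finally show ?case using Suc by simp
  qed (simp add: add.nat_pow_Suc)
  have two: "add_pow R (2::nat) \<one> = \<one> \<oplus> \<one>"
    by (simp add: numeral_2_eq_2 add.nat_pow_Suc)
  have nz: "(\<one> \<oplus> \<one>) [^] n = \<zero> \<Longrightarrow> \<one> \<oplus> \<one> = \<zero>" for n :: nat
    by (induction n) (auto simp: integral_iff)
  have "\<one> \<oplus> \<one> = \<zero>" using z nz * two by simp
  then have "(\<one> \<oplus> \<one>) \<otimes> a = \<zero>" using assms by simp
  then show ?thesis using assms by (simp add: l_distr)
qed

lemma a_inv_eq [simp]: "a \<in> carrier R \<Longrightarrow> \<ominus> a = a"
  by (simp add: minus_equality)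

lemma a_minus_eq [simp]: "a \<in> carrier R \<Longrightarrow> b \<in> carrier R \<Longrightarrow> a \<ominus> b = a \<oplus> b"
  by (simp add: a_minus_def)

lemma add_add_self [simp]: "a \<in> carrier R \<Longrightarrow> b \<in> carrier R \<Longrightarrow> a \<oplus> (a \<oplus> b) = b"
  by (simp flip: a_assoc)

lemma add_eq_zero_iff: "a \<in> carrier R \<Longrightarrow> b \<in> carrier R \<Longrightarrow> a \<oplus> b = \<zero> \<longleftrightarrow> a = b"
  by (metis a_minus_eq r_right_minus_eq)

lemma frob_add:
  assumes "a \<in> carrier R" "b \<in> carrier R"
  shows "(a \<oplus> b) [^] ((2::nat) ^ k) = a [^] ((2::nat) ^ k) \<oplus> b [^] ((2::nat) ^ k)"
proof (induction k)
  case (Suc k)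
  have sq: "c [^] ((2::nat) ^ Suc k) = c [^] ((2::nat)^k) \<otimes> c [^] ((2::nat)^k)" if "c \<in> carrier R" for c
    using that by (simp add: nat_pow_mult mult_2)
  have "(u \<oplus> v) \<otimes> (u \<oplus> v) = u \<otimes> u \<oplus> v \<otimes> v" if "u \<in> carrier R" "v \<in> carrier R" for u v
  proof -
    have "(u \<oplus> v) \<otimes> (u \<oplus> v) = u \<otimes> u \<oplus> v \<otimes> v \<oplus> (u \<otimes> v \<oplus> u \<otimes> v)"
      using that by algebra
    then show ?thesis using that by simp
  qed
  then show ?case using assms by (simp only: sq a_closed Suc nat_pow_closed)
qed (use assms in simp)

lemma pow_nonzero [simp]: "a \<in> carrier R \<Longrightarrow> a \<noteq> \<zero> \<Longrightarrow> a [^] (n::nat) \<noteq> \<zero>"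
  by (induction n) (auto simp: integral_iff)

lemma frob_hom: "(\<lambda>a. a [^] ((2::nat) ^ k)) \<in> ring_hom R R"
  by (auto simp: ring_hom_def frob_add nat_pow_distrib)

lemma frob_inj: "inj_on (\<lambda>a. a [^] ((2::nat) ^ k)) (carrier R)"
proof (rule inj_onI)
  fix a b assume ab: "a \<in> carrier R" "b \<in> carrier R" "a [^] ((2::nat) ^ k) = b [^] ((2::nat) ^ k)"
  then have "(a \<oplus> b) [^] ((2::nat) ^ k) = \<zero>" by (simp add: frob_add)
  then have "a \<oplus> b = \<zero>" using ab pow_nonzero by blast
  then show "a = b" using ab by (simp add: add_eq_zero_iff)
qed

section \<open>The order of the affine group and primitive elements\<close>

interpretation G: group "AGL1 R" by (rule AGL1_group)
interpretation M: group "mult_of R" by (rule field_mult_group)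

lemma card_AGL1: "card (carrier G) = (2 ^ e - 1) * 2 ^ e"
proof -
  have "inj_on (\<lambda>(a, b). aff R a b) ((carrier R - {\<zero>}) \<times> carrier R)"
    by (auto simp: inj_on_def aff_eq_iff)
  then show ?thesis
    by (simp add: carrier_AGL1 card_image card_cartesian_product card_Diff_singleton card_carrier)
qed

lemma finite_AGL1 [simp, intro]: "finite (carrier G)"
  by (simp add: carrier_AGL1)

lemma four_le: "(4::nat) \<le> 2 ^ e"
  using power_increasing[OF e_ge_2, of "2::nat"] by simp

lemma primitive_closed [simp, dest]: "a \<in> primitive R \<Longrightarrow> a \<in> carrier R"
  and primitive_nonzero [simp]: "a \<in> primitive R \<Longrightarrow> a \<noteq> \<zero>"
  and primitive_ord: "a \<in> primitive R \<Longrightarrow> M.ord a = 2 ^ e - 1"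
  by (auto simp: primitive_def card_carrier)

lemma primitive_not_one [simp]: "a \<in> primitive R \<Longrightarrow> a \<noteq> \<one>"
  using primitive_ord[of a] M.ord_id four_le by auto

lemma primitive_pow_eq_one_iff: "a \<in> primitive R \<Longrightarrow> a [^] (n::nat) = \<one> \<longleftrightarrow> 2 ^ e - 1 dvd n"
  using M.pow_eq_id[of a n] by (simp add: primitive_ord Multiplicative_Group.nat_pow_mult_of)

lemma primitive_generate_iff:
  assumes "a \<in> carrier R" "a \<noteq> \<zero>"
  shows "a \<in> primitive R \<longleftrightarrow> generate (mult_of R) {a} = carrier (mult_of R)"
proof -
  have c: "card (carrier (mult_of R)) = card (carrier R) - 1"
    by (simp add: card_Diff_singleton)
  have sub: "generate (mult_of R) {a} \<subseteq> carrier (mult_of R)"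
    using assms by (intro M.generate_incl) auto
  have ord: "M.ord a = card (generate (mult_of R) {a})"
    using assms by (intro M.generate_pow_card) simp
  show ?thesis
  proof
    assume "a \<in> primitive R"
    then have "card (generate (mult_of R) {a}) = card (carrier (mult_of R))"
      using ord unfolding primitive_def c by simp
    then show "generate (mult_of R) {a} = carrier (mult_of R)"
      using sub by (intro card_subset_eq) simp_all
  next
    assume "generate (mult_of R) {a} = carrier (mult_of R)"
    then show "a \<in> primitive R"
      using ord assms unfolding primitive_def by (simp flip: c)
  qed
qed

lemma primitive_power:
  assumes "a \<in> primitive R" "c \<in> carrier R" "c \<noteq> \<zero>"
  obtains n :: nat where "c = a [^] n"
proof -
  have "c \<in> generate (mult_of R) {a}"
    using assms primitive_generate_iff[of a] by auto
  moreover have "generate (mult_of R) {a} = {a [^] k | k. k \<in> (UNIV :: nat set)}"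
    using M.generate_pow_on_finite_carrier[of a] assms(1)
    by (simp add: Multiplicative_Group.nat_pow_mult_of)
  ultimately show ?thesis using that by blast
qed

text \<open>In characteristic two a^2 + 1 = (a + 1)^2, so 1 has no square root besides itself. Hence
  an involution has linear part 1.\<close>

lemma square_one:
  assumes "a \<in> carrier R" "a \<otimes> a = \<one>" shows "a = \<one>"
proof -
  have "(a \<oplus> \<one>) \<otimes> (a \<oplus> \<one>) = a \<otimes> a \<oplus> \<one> \<oplus> (a \<oplus> a)" using assms(1) by algebra
  then have "(a \<oplus> \<one>) \<otimes> (a \<oplus> \<one>) = \<zero>" using assms by simp
  then show ?thesis using assms by (simp add: integral_iff add_eq_zero_iff)
qed

section \<open>Involutions and generating triples\<close>

lemma ord_eq_2_iff: "G.ord g = 2 \<longleftrightarrow> g \<otimes>\<^bsub>G\<^esub> g = \<one>\<^bsub>G\<^esub> \<and> g \<noteq> \<one>\<^bsub>G\<^esub>" if "g \<in> carrier G"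
proof -
  have "g \<otimes>\<^bsub>G\<^esub> g = g [^]\<^bsub>G\<^esub> (2::nat)" using that by (simp add: numeral_2_eq_2)
  then have "g \<otimes>\<^bsub>G\<^esub> g = \<one>\<^bsub>G\<^esub> \<longleftrightarrow> G.ord g dvd 2" using that by (simp add: G.pow_eq_id)
  moreover have "G.ord g dvd 2 \<longleftrightarrow> G.ord g = 1 \<or> G.ord g = 2"
    by (metis dvd_refl one_dvd prime_nat_iff two_is_prime_nat)
  ultimately show ?thesis using G.ord_eq_1[OF that] by auto
qed

text \<open>Describes the translations by a group equation, so every automorphism maps translations
  to translations.\<close>

lemma square_eq_one_iff:
  assumes "g \<in> carrier G" shows "g \<otimes>\<^bsub>G\<^esub> g = \<one>\<^bsub>G\<^esub> \<longleftrightarrow> lin R g = \<one>"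
proof
  assume "g \<otimes>\<^bsub>G\<^esub> g = \<one>\<^bsub>G\<^esub>"
  then have "lin R g \<otimes> lin R g = \<one>" using assms by (metis lin_mult lin_one)
  then show "lin R g = \<one>" using assms square_one[of "lin R g"] by blast
next
  assume "lin R g = \<one>"
  with assms obtain b where "b \<in> carrier R" "g = aff R \<one> b" using lin_eq_oneD by blast
  then show "g \<otimes>\<^bsub>G\<^esub> g = \<one>\<^bsub>G\<^esub>" by (simp add: AGL1_one)
qed

lemma involution_iff:
  "g \<in> carrier G \<and> G.ord g = 2 \<longleftrightarrow> (\<exists>b\<in>carrier R - {\<zero>}. g = aff R \<one> b)"
proof
  assume g: "g \<in> carrier G \<and> G.ord g = 2"
  then obtain b where "b \<in> carrier R" "g = aff R \<one> b"
    using lin_eq_oneD[of g] square_eq_one_iff[of g] ord_eq_2_iff[of g] by blast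
  then show "\<exists>b\<in>carrier R - {\<zero>}. g = aff R \<one> b"
    using g ord_eq_2_iff[of g] by (auto simp: AGL1_one)
next
  assume "\<exists>b\<in>carrier R - {\<zero>}. g = aff R \<one> b"
  then obtain b where b: "b \<in> carrier R" "b \<noteq> \<zero>" "g = aff R \<one> b" by blast
  then have "g \<in> carrier G" by simp
  moreover have "g \<otimes>\<^bsub>G\<^esub> g = \<one>\<^bsub>G\<^esub>" "g \<noteq> \<one>\<^bsub>G\<^esub>"
    using b by (simp_all add: AGL1_one aff_eq_iff)
  ultimately show "g \<in> carrier G \<and> G.ord g = 2" by (simp add: ord_eq_2_iff)
qed

text \<open>Conjugating the translation by b with x^n gives the translation by a^n b; as a is
  primitive, these are all the nontrivial translations. Multiplying translations by powers of
  \<open>x\<close> then reaches every linear part.\<close>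

lemma generate_affine_pair:
  assumes x: "x \<in> carrier G" "lin R x \<in> primitive R" and b: "b \<in> carrier R" "b \<noteq> \<zero>"
    and Y: "Y \<subseteq> carrier G" "x \<in> Y" "aff R \<one> b \<in> Y"
  shows "generate G Y = carrier G"
proof -
  let ?H = "generate G Y"
  interpret H: subgroup ?H G by (rule G.generate_is_subgroup) fact
  have xH: "x [^]\<^bsub>G\<^esub> n \<in> ?H" for n :: nat
    by (induction n) (use Y in \<open>auto intro: generate.incl\<close>)
  obtain a c where a: "a \<in> primitive R" "c \<in> carrier R" "x = aff R a c"
    using x by (auto elim!: AGL1_cases)
  have trans: "aff R \<one> d \<in> ?H" if d: "d \<in> carrier R" for d
  proof (cases "d = \<zero>")
    case True
    then show ?thesis using H.one_closed by (simp add: AGL1_one)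
  next
    case False
    have ib: "inv b \<in> carrier R" "inv b \<otimes> b = \<one>" "inv b \<noteq> \<zero>"
      using b by (simp_all add: inv_nonzero)
    \<comment> \<open>The exponent with a^n b = d, so that conjugation by x^n turns the given
      translation into the one by \<open>d\<close>.\<close>
    with False d obtain n :: nat where n: "d \<otimes> inv b = a [^] n"
      using primitive_power[OF a(1), of "d \<otimes> inv b"] by (auto simp: integral_iff)
    define w where "w = x [^]\<^bsub>G\<^esub> n"
    have w: "w \<in> carrier G" "lin R w = a [^] n" "w \<in> ?H" using a x xH by (auto simp: w_def)
    then obtain c' where c': "c' \<in> carrier R" "w = aff R (a [^] n) c'"
      by (metis AGL1_cases lin_aff)
    have "a [^] n \<otimes> b = d" using d ib b(1) by (simp add: m_assoc flip: n)
    then have "w \<otimes>\<^bsub>G\<^esub> aff R \<one> b = aff R \<one> d \<otimes>\<^bsub>G\<^esub> w"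
      using c' a b d by (simp add: a_comm)
    then have "aff R \<one> d = w \<otimes>\<^bsub>G\<^esub> aff R \<one> b \<otimes>\<^bsub>G\<^esub> inv\<^bsub>G\<^esub> w"
      using w b d by (metis G.inv_solve_right G.m_closed aff_in_AGL1 one_closed one_not_zero)
    then show ?thesis using w Y by (auto intro: generate.incl)
  qed
  show ?thesis
  proof
    show "carrier G \<subseteq> ?H"
    proof
      fix g assume g: "g \<in> carrier G"
      then obtain a' c' where a': "a' \<in> carrier R" "a' \<noteq> \<zero>" "c' \<in> carrier R" "g = aff R a' c'" ..
      then obtain n :: nat where n: "a' = a [^] n" using primitive_power[OF a(1)] by blast
      let ?w = "x [^]\<^bsub>G\<^esub> n"
      have "lin R (g \<otimes>\<^bsub>G\<^esub> inv\<^bsub>G\<^esub> ?w) = \<one>"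
        using g x a a' n by (simp add: field_Units)
      then obtain d where "d \<in> carrier R" "g \<otimes>\<^bsub>G\<^esub> inv\<^bsub>G\<^esub> ?w = aff R \<one> d"
        using g x lin_eq_oneD[of "g \<otimes>\<^bsub>G\<^esub> inv\<^bsub>G\<^esub> ?w"] by auto
      then have "g = aff R \<one> d \<otimes>\<^bsub>G\<^esub> ?w" "aff R \<one> d \<in> ?H"
        using g x trans by (metis G.inv_solve_right' G.nat_pow_closed G.m_closed G.inv_closed, auto)
      then show "g \<in> ?H" using xH by auto
    qed
  qed (rule H.subset)
qed

text \<open>Necessity of primitivity: the elements whose linear part is generated by that of
  \<open>x\<close> form a subgroup containing \<open>x\<close>, \<open>y\<close> and
  \<open>z\<close>, hence the whole group, whose linear parts exhaust the multiplicative group of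
  the field.\<close>

lemma map_triples_iff:
  "(x, y, z) \<in> map_triples G \<longleftrightarrow>
    x \<in> carrier G \<and> lin R x \<in> primitive R \<and> (\<exists>b\<in>carrier R - {\<zero>}. y = aff R \<one> b) \<and>
    z = inv\<^bsub>G\<^esub> (x \<otimes>\<^bsub>G\<^esub> y)" (is "?L \<longleftrightarrow> ?R")
proof
  assume ?L
  then have x: "x \<in> carrier G" "y \<in> carrier G" "z \<in> carrier G" "G.ord y = 2"
    "generate G {x, y, z} = carrier G" "x \<otimes>\<^bsub>G\<^esub> y \<otimes>\<^bsub>G\<^esub> z = \<one>\<^bsub>G\<^esub>"
    by (auto simp: map_triples_def)
  then obtain b where b: "b \<in> carrier R" "b \<noteq> \<zero>" "y = aff R \<one> b"
    using involution_iff by blast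
  have z: "z = inv\<^bsub>G\<^esub> (x \<otimes>\<^bsub>G\<^esub> y)"
    using x G.inv_equality[of z "x \<otimes>\<^bsub>G\<^esub> y"] G.inv_comm[of "x \<otimes>\<^bsub>G\<^esub> y" z] by simp
  let ?L = "generate (mult_of R) {lin R x}"
  have sub: "subgroup ?L (mult_of R)" using x by (intro M.generate_is_subgroup) auto
  then interpret L: subgroup ?L "mult_of R" .
  have Linv: "inv (lin R g) \<in> ?L" if "g \<in> carrier G" "lin R g \<in> ?L" for g
    using L.m_inv_closed[OF that(2)] that(1) by (simp add: m_inv_mult_of)
  have "subgroup {g \<in> carrier G. lin R g \<in> ?L} G"
    using L.one_closed Linv L.m_closed by (intro G.subgroupI) (auto intro: exI[of _ "\<one>\<^bsub>G\<^esub>"])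
  moreover have lx: "lin R x \<in> ?L" by (simp add: generate.incl)
  moreover have "lin R z \<in> ?L"
    using x b z lx L.m_inv_closed[OF lx] by (simp add: m_inv_mult_of)
  ultimately have "generate G {x, y, z} \<subseteq> {g \<in> carrier G. lin R g \<in> ?L}"
    using x b L.one_closed by (intro G.generate_subgroup_incl) auto
  then have L: "lin R g \<in> ?L" if "g \<in> carrier G" for g using x that by auto
  have "a \<in> ?L" if "a \<in> carrier (mult_of R)" for a
    using L[of "aff R a \<zero>"] that by simp
  then have "lin R x \<in> primitive R"
    using x primitive_generate_iff[of "lin R x"] L.subset by auto
  then show ?R using x b z by auto
next
  assume ?R
  then obtain b where x: "x \<in> carrier G" "lin R x \<in> primitive R"
    "z = inv\<^bsub>G\<^esub> (x \<otimes>\<^bsub>G\<^esub> y)" "b \<in> carrier R" "b \<noteq> \<zero>" "y = aff R \<one> b" by auto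
  moreover have "G.ord y = 2" using x involution_iff by auto
  moreover have "generate G {x, y, z} = carrier G"
    using x by (intro generate_affine_pair[of x b]) auto
  ultimately show ?L by (auto simp: map_triples_def)
qed

section \<open>Automorphisms induced by semilinear maps\<close>

lemma semi_conj_aff:
  assumes "s \<in> ring_hom R R" "u \<in> carrier R" "v \<in> carrier R"
    "a \<in> carrier R" "a \<noteq> \<zero>" "b \<in> carrier R"
  shows "semi_conj R s u v (aff R a b) = aff R (s a) (u \<otimes> s b \<oplus> (v \<oplus> s a \<otimes> v))"
  using assms by (simp add: semi_conj_def ring_hom_closed)

text \<open>Injectivity of \<open>s\<close> makes the induced endomorphism injective, and the group
  is finite, so surjectivity is automatic.\<close>

lemma semi_conj_auto:
  assumes s: "s \<in> ring_hom R R" "inj_on s (carrier R)"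
    and uv: "u \<in> carrier R" "u \<noteq> \<zero>" "v \<in> carrier R"
  shows "semi_conj R s u v \<in> auto G"
proof -
  note [simp] = semi_conj_aff[OF s(1) uv(1,3)]
  have 0: "s \<zero> = \<zero>" using ring_hom_zero[OF s(1)] is_ring by simp
  have [simp]: "s a \<in> carrier R" if "a \<in> carrier R" for a using that s by (simp add: ring_hom_closed)
  have [simp]: "s a \<noteq> \<zero>" if "a \<in> carrier R" "a \<noteq> \<zero>" for a
    using that s(2) 0 by (metis inj_onD zero_closed)
  have maps: "semi_conj R s u v \<in> carrier G \<rightarrow> carrier G"
    using uv by (auto elim!: AGL1_cases)
  have "semi_conj R s u v \<in> hom G G"
  proof (rule homI)
    fix f g assume "f \<in> carrier G" "g \<in> carrier G"
    then obtain a b c d where f: "a \<in> carrier R" "a \<noteq> \<zero>" "b \<in> carrier R" "f = aff R a b"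
      and g: "c \<in> carrier R" "c \<noteq> \<zero>" "d \<in> carrier R" "g = aff R c d" by (metis AGL1_cases)
    \<comment> \<open>\<open>A\<close> to \<open>D\<close> stand for the images under
      \<open>s\<close> of the four coefficients. The two sides differ by A v + A v, which vanishes
      in characteristic two.\<close>
    have "u \<otimes> (A \<otimes> D \<oplus> B) \<oplus> (v \<oplus> A \<otimes> C \<otimes> v) =
      A \<otimes> (u \<otimes> D \<oplus> (v \<oplus> C \<otimes> v)) \<oplus> (u \<otimes> B \<oplus> (v \<oplus> A \<otimes> v))"
      if "A \<in> carrier R" "B \<in> carrier R" "C \<in> carrier R" "D \<in> carrier R" for A B C D
    proof -
      have "A \<otimes> (u \<otimes> D \<oplus> (v \<oplus> C \<otimes> v)) \<oplus> (u \<otimes> B \<oplus> (v \<oplus> A \<otimes> v)) =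
        u \<otimes> (A \<otimes> D \<oplus> B) \<oplus> (v \<oplus> A \<otimes> C \<otimes> v) \<oplus> (A \<otimes> v \<oplus> A \<otimes> v)"
        using that uv by algebra
      then show ?thesis using that uv by simp
    qed
    then show "semi_conj R s u v (f \<otimes>\<^bsub>G\<^esub> g) = semi_conj R s u v f \<otimes>\<^bsub>G\<^esub> semi_conj R s u v g"
      using f g uv ring_hom_mult[OF s(1)] ring_hom_add[OF s(1)]
      by (simp add: integral_iff)
  qed (use maps in auto)
  moreover have "inj_on (semi_conj R s u v) (carrier G)"
  proof (rule inj_onI)
    fix f g assume fg: "f \<in> carrier G" "g \<in> carrier G" "semi_conj R s u v f = semi_conj R s u v g"
    then obtain a b c d where f: "a \<in> carrier R" "a \<noteq> \<zero>" "b \<in> carrier R" "f = aff R a b"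
      and g: "c \<in> carrier R" "c \<noteq> \<zero>" "d \<in> carrier R" "g = aff R c d" by (metis AGL1_cases)
    have "s a = s c \<and> u \<otimes> s b \<oplus> (v \<oplus> s a \<otimes> v) = u \<otimes> s d \<oplus> (v \<oplus> s c \<otimes> v)"
      using fg(3) f g uv by (subst aff_eq_iff[symmetric]) simp_all
    then have "s a = s c" and eq: "u \<otimes> s b \<oplus> (v \<oplus> s a \<otimes> v) = u \<otimes> s d \<oplus> (v \<oplus> s c \<otimes> v)"
      by blast+
    from \<open>s a = s c\<close> have "a = c" using s(2) f g by (meson inj_onD)
    have "u \<otimes> s b = u \<otimes> s d"
      using eq[unfolded \<open>s a = s c\<close>] f g uv by (subst (asm) add.right_cancel) simp_all
    then have "s b = s d" using f g uv by (simp add: m_lcancel)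
    then have "b = d" using s(2) f g by (meson inj_onD)
    then show "f = g" using \<open>a = c\<close> f g by simp
  qed
  then have "bij_betw (semi_conj R s u v) (carrier G) (carrier G)"
    using maps finite_AGL1 by (simp add: bij_betw_def endo_inj_surj funcset_image)
  ultimately show ?thesis by (simp add: auto_def Bij_def semi_conj_def)
qed

lemma semi_conj_triple:
  assumes s: "s \<in> ring_hom R R" "inj_on s (carrier R)"
    and t: "(x, y, z) \<in> map_triples G" "(x', y', z') \<in> map_triples G"
    and lin: "lin R x' = s (lin R x)"
  shows "\<exists>\<alpha>\<in>auto G. (x', y', z') = apply_triple \<alpha> (x, y, z)"
proof -
  from t(1) obtain b where "b \<in> carrier R" "b \<noteq> \<zero>" "y = aff R \<one> b" "x \<in> carrier G"
    "lin R x \<in> primitive R" "z = inv\<^bsub>G\<^esub> (x \<otimes>\<^bsub>G\<^esub> y)"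
    unfolding map_triples_iff by blast
  moreover from \<open>x \<in> carrier G\<close> obtain a c where "a \<in> carrier R" "c \<in> carrier R" "x = aff R a c"
    by (metis AGL1_cases)
  ultimately have x: "a \<in> primitive R" "b \<in> carrier R" "b \<noteq> \<zero>" "c \<in> carrier R"
    "x = aff R a c" "y = aff R \<one> b" "x \<in> carrier G" "y \<in> carrier G" "z = inv\<^bsub>G\<^esub> (x \<otimes>\<^bsub>G\<^esub> y)"
    by auto
  from t(2) obtain b' where "b' \<in> carrier R" "b' \<noteq> \<zero>" "y' = aff R \<one> b'" "x' \<in> carrier G"
    "lin R x' \<in> primitive R" "z' = inv\<^bsub>G\<^esub> (x' \<otimes>\<^bsub>G\<^esub> y')"
    unfolding map_triples_iff by blast
  moreover from \<open>x' \<in> carrier G\<close> obtain a' c' where "a' \<in> carrier R" "c' \<in> carrier R" "x' = aff R a' c'"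
    by (metis AGL1_cases)
  ultimately have x': "a' \<in> primitive R" "b' \<in> carrier R" "b' \<noteq> \<zero>" "c' \<in> carrier R"
    "x' = aff R a' c'" "y' = aff R \<one> b'" "x' \<in> carrier G" "y' \<in> carrier G" "z' = inv\<^bsub>G\<^esub> (x' \<otimes>\<^bsub>G\<^esub> y')"
    by auto
  have a': "a' = s a" using lin x x' by simp
  have S[simp]: "s a \<in> carrier R" "s b \<in> carrier R" "s c \<in> carrier R" "s \<one> = \<one>"
    using x s by (auto simp: ring_hom_closed ring_hom_one)
  have "s b \<noteq> \<zero>"
    using x s ring_hom_zero[OF s(1)] is_ring by (metis inj_onD zero_closed)
  then have ib: "inv (s b) \<in> carrier R" "inv (s b) \<otimes> s b = \<one>" "inv (s b) \<noteq> \<zero>"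
    using inv_nonzero[of "s b"] by simp_all
  have "\<one> \<oplus> a' \<noteq> \<zero>" using x' by (metis add_eq_zero_iff one_closed primitive_closed primitive_not_one)
  then have ia: "inv (\<one> \<oplus> a') \<in> carrier R" "(\<one> \<oplus> a') \<otimes> inv (\<one> \<oplus> a') = \<one>"
    using x' inv_nonzero[of "\<one> \<oplus> a'"] by simp_all
  \<comment> \<open>Matching \<open>y\<close> forces u s(b) = b'. Matching \<open>x\<close> forces
    (1 + a') v = c' + u s(c), which is solvable because a' differs from 1.\<close>
  define u where "u = b' \<otimes> inv (s b)"
  define v where "v = inv (\<one> \<oplus> a') \<otimes> (c' \<oplus> u \<otimes> s c)"
  have u: "u \<in> carrier R" "u \<noteq> \<zero>" using ib x' by (auto simp: u_def integral_iff)
  have v: "v \<in> carrier R" using u x' x ia by (auto simp: v_def)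
  let ?\<alpha> = "semi_conj R s u v"
  have auto: "?\<alpha> \<in> auto G" by (rule semi_conj_auto[OF s u v])
  interpret A: group_hom G G ?\<alpha> using auto by unfold_locales (simp add: auto_def)
  have "u \<otimes> s b = b'" using ib x' by (simp add: u_def m_assoc)
  then have y: "?\<alpha> y = y'" using x x' u v s by (simp add: semi_conj_aff)
  have "v \<oplus> a' \<otimes> v = (\<one> \<oplus> a') \<otimes> v" using x' v by (simp add: l_distr)
  also have "\<dots> = c' \<oplus> u \<otimes> s c" using ia x' u by (simp add: v_def flip: m_assoc)
  finally have "u \<otimes> s c \<oplus> (v \<oplus> a' \<otimes> v) = c'" using x' u by (simp add: a_comm[of c'])
  then have "?\<alpha> x = x'" using x x' u v s a' by (simp add: semi_conj_aff)
  moreover from this y have "?\<alpha> z = z'"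
    unfolding x(9) x'(9) using x(7,8) by simp
  ultimately have "(x', y', z') = apply_triple ?\<alpha> (x, y, z)"
    using y by (simp add: apply_triple_def)
  with auto show ?thesis by blast
qed

subsection \<open>Automorphisms and Frobenius conjugates\<close>

lemma additive_finsum:
  assumes f: "f \<in> carrier R \<rightarrow> carrier R"
    "\<And>a b. a \<in> carrier R \<Longrightarrow> b \<in> carrier R \<Longrightarrow> f (a \<oplus> b) = f a \<oplus> f b"
    and "finite A" "h \<in> A \<rightarrow> carrier R"
  shows "f (finsum R h A) = finsum R (\<lambda>i. f (h i)) A"
proof -
  have "f \<zero> \<oplus> f \<zero> = f \<zero>" using f by (metis l_zero zero_closed)
  then have 0: "f \<zero> = \<zero>" using f add_self by (metis funcset_mem zero_closed)
  from assms(3,4) show ?thesis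
  proof (induction A)
    case (insert i A)
    have "(\<lambda>i. f (h i)) \<in> A \<rightarrow> carrier R" "f (h i) \<in> carrier R" "h i \<in> carrier R" "h \<in> A \<rightarrow> carrier R"
      using insert f by auto
    then show ?case using insert f by (simp add: finsum_insert)
  qed (simp add: 0)
qed

lemma primitive_pow_eq_iff:
  assumes "a \<in> primitive R"
  shows "a [^] (m::nat) = a [^] n \<longleftrightarrow> m mod (2 ^ e - 1) = n mod (2 ^ e - 1)"
proof -
  have *: "a [^] m = a [^] n \<longleftrightarrow> m mod (2 ^ e - 1) = n mod (2 ^ e - 1)" if "m \<le> n" for m n :: nat
  proof -
    have "a [^] m = a [^] n \<longleftrightarrow> a [^] m \<otimes> \<one> = a [^] m \<otimes> a [^] (n - m)"
      using that assms by (simp add: nat_pow_mult)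
    also have "\<dots> \<longleftrightarrow> a [^] (n - m) = \<one>"
      using assms by (subst m_lcancel) auto
    also have "\<dots> \<longleftrightarrow> m mod (2 ^ e - 1) = n mod (2 ^ e - 1)"
      using primitive_pow_eq_one_iff[OF assms] mod_eq_dvd_iff_nat[OF that] by metis
    finally show ?thesis .
  qed
  show ?thesis using *[of m n] *[of n m] by (cases "m \<le> n") auto
qed

text \<open>The exponents 2^k with k < e lie below 2^e - 1, the order of \<open>a\<close>, so they
  are distinct modulo it. The strict bound 2^(e-1) < 2^e - 1 is where e must be at least 2.\<close>

lemma frob_orbit_inj:
  assumes "a \<in> primitive R"
  shows "inj_on (\<lambda>k. a [^] ((2::nat) ^ k)) {..<e}"
proof (rule inj_onI)
  fix k l assume kl: "k \<in> {..<e}" "l \<in> {..<e}" "a [^] ((2::nat) ^ k) = a [^] ((2::nat) ^ l)"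
  have "(2::nat) ^ i < 2 ^ e - 1" if "i < e" for i
  proof -
    have "(2::nat) ^ i \<le> 2 ^ (e - 1)" using that by (intro power_increasing) auto
    moreover have "(2::nat) ^ e = 2 * 2 ^ (e - 1)" using e_ge_2 by (cases e) auto
    ultimately show ?thesis using four_le by linarith
  qed
  then show "k = l" using kl assms by (simp add: primitive_pow_eq_iff)
qed

text \<open>The sums of the powers \<open>a\<^sup>i\<close> over the \<open>2\<^sup>e\<^sup>+\<^sup>1\<close> subsets of \<open>{0..e}\<close> cannot all be distinct.\<close>

lemma binary_relation_exists:
  assumes a: "a \<in> carrier R"
  obtains S where "S \<subseteq> {..e}" "S \<noteq> {}" "(\<Oplus>i\<in>S. a [^] i) = \<zero>"
proof -
  let ?f = "\<lambda>S. \<Oplus>i\<in>S. a [^] (i::nat)"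
  have cl: "?f S \<in> carrier R" for S using a by (intro finsum_closed) auto
  have "card (?f ` Pow {..e}) \<le> card (carrier R)" using cl by (intro card_mono) auto
  also have "\<dots> < card (Pow {..e})" by (simp add: card_Pow card_carrier)
  finally have "\<not> inj_on ?f (Pow {..e})" using pigeonhole by blast
  then obtain S T where ST: "S \<subseteq> {..e}" "T \<subseteq> {..e}" "S \<noteq> T" "?f S = ?f T" by (auto simp: inj_on_def)
  have fin: "finite S" "finite T" using ST finite_subset by auto
  have un: "?f (A \<union> B) = ?f A \<oplus> ?f B" if "finite A" "finite B" "A \<inter> B = {}" for A B
    using that a by (intro finsum_Un_disjoint) auto
  have S: "?f S = ?f (S - T) \<oplus> ?f (S \<inter> T)" using un[of "S - T" "S \<inter> T"] fin
    by (metis Diff_disjoint Int_Diff_Un finite_Diff finite_Int inf_commute sup_commute Int_Diff_disjoint)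
  have T: "?f T = ?f (T - S) \<oplus> ?f (S \<inter> T)" using un[of "T - S" "S \<inter> T"] fin
    by (metis Diff_disjoint Int_Diff_Un finite_Diff finite_Int inf_commute sup_commute Int_Diff_disjoint)
  \<comment> \<open>The common terms cancel. In characteristic two the two equal remainders add up
    to zero, so the symmetric difference is the required index set.\<close>
  have "?f (S - T) = ?f (T - S)" using S T ST(4) cl by (metis add.right_cancel)
  moreover have "?f ((S - T) \<union> (T - S)) = ?f (S - T) \<oplus> ?f (T - S)" using fin by (intro un) auto
  ultimately have "?f ((S - T) \<union> (T - S)) = \<zero>" using cl by simp
  moreover have "(S - T) \<union> (T - S) \<subseteq> {..e}" "(S - T) \<union> (T - S) \<noteq> {}" using ST by auto
  ultimately show ?thesis using that by blast
qed

text \<open>The indicator function of \<open>S\<close>, as a coefficient sequence, is a nonzero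
  polynomial of degree at most e, and a polynomial over a field has at most as many roots as its
  degree.\<close>

lemma card_binary_roots:
  assumes S: "S \<subseteq> {..e}" "S \<noteq> {}"
  shows "card {b \<in> carrier R. (\<Oplus>i\<in>S. b [^] i) = \<zero>} \<le> e"
proof -
  define p where "p = (\<lambda>i. if i \<in> S then \<one> else \<zero>)"
  have "bound \<zero> e p" using S by (intro bound.intro) (auto simp: p_def)
  moreover have "p i \<in> carrier R" for i by (simp add: p_def)
  ultimately have p: "p \<in> up R" unfolding up_def by blast
  then have pc: "p \<in> carrier (UP R)" by (simp add: UP_def)
  have co: "up_ring.coeff (UP R) p = p" using p by (simp add: UP_def)
  have cp: "up_ring.coeff (UP R) p i = (if i \<in> S then \<one> else \<zero>)" for i
    unfolding co by (simp add: p_def)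
  obtain i where i: "i \<in> S" using S by blast
  have nz: "p \<noteq> \<zero>\<^bsub>UP R\<^esub>"
  proof
    assume "p = \<zero>\<^bsub>UP R\<^esub>"
    then have "p i = \<zero>" by (simp add: UP_def)
    then show False using i by (simp add: p_def)
  qed
  have neutral: "(\<Oplus>i\<in>{..n}. p i \<otimes> b [^] i) = (\<Oplus>i\<in>S. b [^] i)"
    if "S \<subseteq> {..n}" "b \<in> carrier R" for n b
    by (rule add.finprod_mono_neutral_cong_right) (use that in \<open>auto simp: p_def\<close>)
  interpret UP_domain R "UP R" by unfold_locales simp
  have deg: "deg R p \<le> e" using pc S by (intro deg_aboveI) (auto simp: cp)
  \<comment> \<open>\<open>UnivPoly.eval\<close> sums only up to the actual degree, so every
    exponent in \<open>S\<close> must be seen to lie within that range.\<close>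
  have S': "S \<subseteq> {..deg R p}" using pc by (auto simp: cp intro!: deg_belowI)
  have "UnivPoly.eval R R id b p = (\<Oplus>i\<in>S. b [^] i)" if "b \<in> carrier R" for b
  proof -
    have "UnivPoly.eval R R id b p = (\<Oplus>i\<in>{..deg R p}. p i \<otimes> b [^] i)"
      using pc by (simp add: eval_on_carrier co)
    also have "\<dots> = (\<Oplus>i\<in>S. b [^] i)"
      using S' that by (rule neutral)
    finally show ?thesis .
  qed
  then have "{b \<in> carrier R. (\<Oplus>i\<in>S. b [^] i) = \<zero>} = {b \<in> carrier R. UnivPoly.eval R R id b p = \<zero>}" by auto
  then show ?thesis using roots_bound[OF pc nz] deg by auto
qed

text \<open>Sums over finite sets of exponents encode polynomials over the prime field. The relevant
  set is found only inside the proof, hence \<open>rel\<close> is asked of every finite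
  \<open>S\<close>.\<close>

lemma frob_conjugate:
  assumes a: "a \<in> primitive R" and b: "b \<in> carrier R"
    and rel: "\<And>S. finite S \<Longrightarrow> (\<Oplus>i\<in>S. a [^] i) = \<zero> \<Longrightarrow> (\<Oplus>i\<in>S. b [^] (i::nat)) = \<zero>"
  shows "\<exists>k<e. b = a [^] ((2::nat) ^ k)"
proof -
  obtain S where S: "S \<subseteq> {..e}" "S \<noteq> {}" "(\<Oplus>i\<in>S. a [^] i) = \<zero>"
    using binary_relation_exists[of a] a by auto
  have fin: "finite S" using S(1) finite_subset by auto
  let ?T = "{b \<in> carrier R. (\<Oplus>i\<in>S. b [^] i) = \<zero>}"
  let ?O = "(\<lambda>k. a [^] ((2::nat) ^ k)) ` {..<e}"
  have "?O \<subseteq> ?T"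
  proof (intro image_subsetI CollectI conjI)
    fix k
    have "(\<Oplus>i\<in>S. (a [^] ((2::nat) ^ k)) [^] i) = (\<Oplus>i\<in>S. (a [^] i) [^] ((2::nat) ^ k))"
      using a by (simp add: nat_pow_pow mult.commute)
    also have "\<dots> = (\<Oplus>i\<in>S. a [^] i) [^] ((2::nat) ^ k)"
      using a fin by (intro additive_finsum[symmetric]) (auto simp: frob_add)
    finally show "(\<Oplus>i\<in>S. (a [^] ((2::nat) ^ k)) [^] i) = \<zero>" using S by (simp add: nat_pow_zero)
  qed (use a in auto)
  moreover have "card ?O = e" using frob_orbit_inj[OF a] by (simp add: card_image)
  ultimately have "?O = ?T" using card_binary_roots[OF S(1,2)] by (intro card_seteq) auto
  moreover have "b \<in> ?T" using rel[OF fin S(3)] b by auto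
  ultimately show ?thesis by auto
qed

text \<open>An automorphism restricts to an additive map on the translations, which form the set of
  solutions of \<open>g\<^sup>2 = 1\<close>; it turns multiplication by \<open>a\<close> into multiplication by the linear part of
  the image, so both satisfy the same polynomial equations over the prime field.\<close>

lemma lin_auto:
  assumes \<alpha>: "\<alpha> \<in> auto G" and x: "x \<in> carrier G" "lin R x \<in> primitive R"
  shows "\<exists>k<e. lin R (\<alpha> x) = lin R x [^] ((2::nat) ^ k)"
proof -
  interpret A: group_hom G G \<alpha> using \<alpha> by (rule G.auto_group_hom)
  \<comment> \<open>The translation vector of the image of a translation, read off at zero.\<close>
  define \<beta> where "\<beta> r = \<alpha> (aff R \<one> r) \<zero>" for r
  let ?a = "lin R x" and ?a' = "lin R (\<alpha> x)"
  have \<beta>: "\<beta> r \<in> carrier R \<and> \<alpha> (aff R \<one> r) = aff R \<one> (\<beta> r)" if "r \<in> carrier R" for r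
  proof -
    have "\<alpha> (aff R \<one> r) \<otimes>\<^bsub>G\<^esub> \<alpha> (aff R \<one> r) = \<one>\<^bsub>G\<^esub>"
      using that A.hom_one by (simp add: AGL1_one flip: A.hom_mult)
    moreover have "\<alpha> (aff R \<one> r) \<in> carrier G" using that by simp
    ultimately obtain s where "s \<in> carrier R" "\<alpha> (aff R \<one> r) = aff R \<one> s"
      using square_eq_one_iff lin_eq_oneD by metis
    then show ?thesis by (simp add: \<beta>_def)
  qed
  have add: "\<beta> (r \<oplus> s) = \<beta> r \<oplus> \<beta> s" if rs: "r \<in> carrier R" "s \<in> carrier R" for r s
  proof -
    have "\<alpha> (aff R \<one> (s \<oplus> r)) = \<alpha> (aff R \<one> r) \<otimes>\<^bsub>G\<^esub> \<alpha> (aff R \<one> s)"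
      using rs by (simp flip: A.hom_mult)
    then have "aff R \<one> (\<beta> (s \<oplus> r)) = aff R \<one> (\<beta> s \<oplus> \<beta> r)" using rs \<beta> by simp
    then show ?thesis using rs \<beta> by (simp add: aff_eq_iff a_comm)
  qed
  have mult: "\<beta> (?a \<otimes> r) = ?a' \<otimes> \<beta> r" if r: "r \<in> carrier R" for r
  proof -
    obtain a c where ac: "a \<in> carrier R" "a \<noteq> \<zero>" "c \<in> carrier R" "x = aff R a c" using x(1) ..
    have "\<alpha> x \<in> carrier G" using x by simp
    then obtain a' c' where ac': "a' \<in> carrier R" "a' \<noteq> \<zero>" "c' \<in> carrier R" "\<alpha> x = aff R a' c'" ..
    \<comment> \<open>Moving the translation by r past \<open>x\<close> multiplies r by a; applying
      \<alpha> to this relation gives the same rule for \<beta> with a'.\<close>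
    have "x \<otimes>\<^bsub>G\<^esub> aff R \<one> r = aff R \<one> (a \<otimes> r) \<otimes>\<^bsub>G\<^esub> x"
      using ac r by (simp add: a_comm)
    then have "\<alpha> x \<otimes>\<^bsub>G\<^esub> aff R \<one> (\<beta> r) = aff R \<one> (\<beta> (a \<otimes> r)) \<otimes>\<^bsub>G\<^esub> \<alpha> x"
      using \<beta>[of r] \<beta>[of "a \<otimes> r"] r ac x(1) A.hom_mult
      by (metis aff_in_AGL1 m_closed one_closed one_not_zero)
    then have "a' \<otimes> \<beta> r \<oplus> c' = c' \<oplus> \<beta> (a \<otimes> r)"
      using ac ac' r \<beta> by (simp add: aff_eq_iff)
    then have "c' \<oplus> a' \<otimes> \<beta> r = c' \<oplus> \<beta> (a \<otimes> r)"
      using ac ac' r \<beta> by (simp add: a_comm)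
    then show ?thesis using ac ac' r \<beta> by simp
  qed
  have a': "?a' \<in> carrier R" using x by simp
  \<comment> \<open>By iteration from 1, every power of the linear part is carried to the
    corresponding power of its image times \<beta>(1). This common factor is nonzero, so it cancels
    from any polynomial relation.\<close>
  have pow: "\<beta> (?a [^] n) = ?a' [^] n \<otimes> \<beta> \<one>" for n :: nat
  proof (induction n)
    case (Suc n)
    have "\<beta> (?a [^] Suc n) = \<beta> (?a \<otimes> ?a [^] n)" using x by (simp add: m_comm)
    also have "\<dots> = ?a' \<otimes> (?a' [^] n \<otimes> \<beta> \<one>)" using x Suc mult by simp
    also have "\<dots> = ?a' [^] Suc n \<otimes> \<beta> \<one>"
      using a' \<beta>[of \<one>] by (simp add: m_assoc m_lcomm)
    finally show ?case .
  qed (use \<beta> in simp)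
  have nz: "\<beta> \<one> \<noteq> \<zero>"
  proof
    assume "\<beta> \<one> = \<zero>"
    then have "\<alpha> (aff R \<one> \<one>) = \<alpha> \<one>\<^bsub>G\<^esub>" using \<beta>[of \<one>] A.hom_one by (simp add: AGL1_one)
    then have "aff R \<one> \<one> = aff R \<one> \<zero>" using G.auto_inj[OF \<alpha>] by (simp add: inj_onD AGL1_one)
    then show False by (simp add: aff_eq_iff)
  qed
  show ?thesis
  proof (rule frob_conjugate)
    fix S :: "nat set" assume S: "finite S" "(\<Oplus>i\<in>S. ?a [^] i) = \<zero>"
    have "\<beta> \<zero> = \<zero>" using \<beta>[of \<zero>] A.hom_one by (simp add: AGL1_one aff_eq_iff)
    then have "\<zero> = \<beta> (\<Oplus>i\<in>S. ?a [^] i)" using S by simp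
    also have "\<dots> = (\<Oplus>i\<in>S. \<beta> (?a [^] i))"
      using S x add \<beta> by (intro additive_finsum) auto
    also have "\<dots> = (\<Oplus>i\<in>S. ?a' [^] i) \<otimes> \<beta> \<one>"
      using S a' \<beta>[of \<one>] by (simp add: pow finsum_ldistr)
    finally have "(\<Oplus>i\<in>S. ?a' [^] i) \<otimes> \<beta> \<one> = \<zero>" by (rule sym)
    moreover have "(\<Oplus>i\<in>S. ?a' [^] i) \<in> carrier R" using a' by (intro finsum_closed) auto
    ultimately show "(\<Oplus>i\<in>S. ?a' [^] i) = \<zero>" using nz \<beta>[of \<one>] integral by blast
  qed (use x in auto)
qed

text \<open>The bounded form gives the orbit as the image of {..<e}, whose size can be counted; the
  unbounded form is the convenient one for testing equality of classes.\<close>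

lemma map_equiv_iff:
  assumes "(x, y, z) \<in> map_triples G" "(x', y', z') \<in> map_triples G"
  shows "((x, y, z), (x', y', z')) \<in> map_equiv G \<longleftrightarrow> (\<exists>k<e. lin R x' = lin R x [^] ((2::nat) ^ k))" (is ?th1)
    and "((x, y, z), (x', y', z')) \<in> map_equiv G \<longleftrightarrow> (\<exists>k. lin R x' = lin R x [^] ((2::nat) ^ k))" (is ?th2)
proof -
  have "\<exists>k<e. lin R x' = lin R x [^] ((2::nat) ^ k)" if "((x, y, z), (x', y', z')) \<in> map_equiv G"
    using that assms lin_auto unfolding map_equiv_def map_triples_iff by auto
  moreover have "((x, y, z), (x', y', z')) \<in> map_equiv G" if "lin R x' = lin R x [^] ((2::nat) ^ k)" for k
    using semi_conj_triple[OF frob_hom frob_inj assms that] assms by (auto simp: map_equiv_def)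
  ultimately show ?th1 ?th2 by blast+
qed

subsection \<open>The maps and their graph\<close>

lemma primitive_pow_iff:
  assumes "a \<in> primitive R"
  shows "a [^] (n::nat) \<in> primitive R \<longleftrightarrow> coprime n (2 ^ e - 1)"
proof -
  have "M.ord (a [^] n) = M.ord a \<longleftrightarrow> coprime n (M.ord a)"
    using M.pow_ord_eq_ord_iff[of a n] assms by (simp add: Multiplicative_Group.nat_pow_mult_of)
  moreover have "a [^] n \<in> primitive R \<longleftrightarrow> M.ord (a [^] n) = 2 ^ e - 1"
    using primitive_closed[OF assms] primitive_nonzero[OF assms] unfolding primitive_def card_carrier by simp
  ultimately show ?thesis using assms by (simp add: primitive_ord)
qed

lemma frob_primitive: "a \<in> primitive R \<Longrightarrow> a [^] ((2::nat) ^ k) \<in> primitive R"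
  using e_ge_2 by (simp add: primitive_pow_iff)

lemma map_triples_exI:
  assumes "a \<in> primitive R"
  obtains x y z where "(x, y, z) \<in> map_triples G" "lin R x = a"
proof -
  have "(aff R a \<zero>, aff R \<one> \<one>, inv\<^bsub>G\<^esub> (aff R a \<zero> \<otimes>\<^bsub>G\<^esub> aff R \<one> \<one>)) \<in> map_triples G"
    using assms unfolding map_triples_iff by (auto intro!: bexI[of _ \<one>])
  then show ?thesis using assms by (intro that) auto
qed

lemma ormaps_cases:
  assumes "N \<in> ormaps G"
  obtains x y z where "(x, y, z) \<in> map_triples G" "N = map_equiv G `` {(x, y, z)}"
  using assms by (auto simp: ormaps_def elim!: quotientE)

lemma ormapsI: "t \<in> map_triples G \<Longrightarrow> map_equiv G `` {t} \<in> ormaps G"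
  by (simp add: ormaps_def quotientI)

lemma map_equiv_class_eq_iff:
  assumes "(x, y, z) \<in> map_triples G" "(x', y', z') \<in> map_triples G"
  shows "map_equiv G `` {(x, y, z)} = map_equiv G `` {(x', y', z')} \<longleftrightarrow>
    (\<exists>k. lin R x' = lin R x [^] ((2::nat) ^ k))"
  using assms by (simp add: eq_equiv_class_iff[OF G.map_equiv_equiv] map_equiv_iff(2))

lemma lin_image_class:
  assumes "(x, y, z) \<in> map_triples G"
  shows "(\<lambda>(x, y, z). lin R x) ` (map_equiv G `` {(x, y, z)}) =
    (\<lambda>k. lin R x [^] ((2::nat) ^ k)) ` {..<e}" (is "?f ` ?C = ?O")
proof
  show "?f ` ?C \<subseteq> ?O"
  proof
    fix b assume "b \<in> ?f ` ?C"
    then obtain x' y' z' where b: "((x, y, z), (x', y', z')) \<in> map_equiv G" "b = lin R x'" by auto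
    then have "(x', y', z') \<in> map_triples G" by (simp add: map_equiv_def)
    then show "b \<in> ?O" using b map_equiv_iff(1)[OF assms] by auto
  qed
  show "?O \<subseteq> ?f ` ?C"
  proof
    fix b assume "b \<in> ?O"
    then obtain k where k: "k < e" "b = lin R x [^] ((2::nat) ^ k)" by auto
    have "lin R x \<in> primitive R" using assms by (simp add: map_triples_iff)
    then obtain x' y' z' where "(x', y', z') \<in> map_triples G" "lin R x' = b"
      using map_triples_exI[of b] frob_primitive k by blast
    then have "((x, y, z), (x', y', z')) \<in> map_equiv G" "b = ?f (x', y', z')"
      using k map_equiv_iff(1)[OF assms] by auto
    then show "b \<in> ?f ` ?C" by blast
  qed
qed

text \<open>The sets of linear parts of the classes partition the primitive elements, and each has e
  members by \<open>lin_image_class\<close> and \<open>frob_orbit_inj\<close>.\<close>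

lemma card_ormaps: "e * card (ormaps G) = totient (2 ^ e - 1)"
proof -
  let ?f = "\<lambda>(x, y, z). lin R x"
  have fin: "finite (ormaps G)"
  proof -
    have "map_triples G \<subseteq> carrier G \<times> carrier G \<times> carrier G" by (auto simp: map_triples_def)
    then have "finite (map_triples G)" by (rule finite_subset) auto
    then show ?thesis unfolding ormaps_def
      by (rule finite_quotient) (auto simp: map_equiv_def)
  qed
  have "primitive R = (\<Union>N\<in>ormaps G. ?f ` N)"
  proof
    show "primitive R \<subseteq> (\<Union>N\<in>ormaps G. ?f ` N)"
    proof
      fix a assume "a \<in> primitive R"
      then obtain x y z where t: "(x, y, z) \<in> map_triples G" "lin R x = a" by (rule map_triples_exI)
      then have "a \<in> ?f ` (map_equiv G `` {(x, y, z)})"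
        using e_ge_2 by (auto simp: lin_image_class image_iff map_triples_iff intro!: bexI[of _ 0])
      then show "a \<in> (\<Union>N\<in>ormaps G. ?f ` N)" using t ormapsI by blast
    qed
    show "(\<Union>N\<in>ormaps G. ?f ` N) \<subseteq> primitive R"
    proof (intro UN_least image_subsetI)
      fix N t assume "N \<in> ormaps G" "t \<in> N"
      then have "t \<in> map_triples G" by (auto elim!: ormaps_cases simp: map_equiv_def)
      then show "?f t \<in> primitive R" by (cases t) (simp add: map_triples_iff)
    qed
  qed
  moreover have "card (\<Union>N\<in>ormaps G. ?f ` N) = (\<Sum>N\<in>ormaps G. card (?f ` N))"
  proof (rule card_UN_disjoint[OF fin])
    show "\<forall>N\<in>ormaps G. finite (?f ` N)"
      by (auto elim!: ormaps_cases simp: lin_image_class)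
    show "\<forall>N\<in>ormaps G. \<forall>N'\<in>ormaps G. N \<noteq> N' \<longrightarrow> ?f ` N \<inter> ?f ` N' = {}"
    proof (intro ballI impI, rule ccontr)
      fix N N' assume N: "N \<in> ormaps G" "N' \<in> ormaps G" "N \<noteq> N'" "?f ` N \<inter> ?f ` N' \<noteq> {}"
      then obtain x y z x' y' z' where t: "(x, y, z) \<in> N" "(x', y', z') \<in> N'" "lin R x = lin R x'"
        by auto
      have mt: "(x, y, z) \<in> map_triples G" "(x', y', z') \<in> map_triples G"
        using N t by (auto elim!: ormaps_cases simp: map_equiv_def)
      then have "lin R x' = lin R x [^] ((2::nat) ^ 0)" using t(3) by (simp add: map_triples_iff)
      then have "((x, y, z), (x', y', z')) \<in> map_equiv G" using map_equiv_iff(2)[OF mt] by blast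
      then show False
        using N t quotient_eqI[OF G.map_equiv_equiv] unfolding ormaps_def by blast
    qed
  qed
  moreover have "card (?f ` N) = e" if N: "N \<in> ormaps G" for N
  proof -
    from N obtain x y z where "(x, y, z) \<in> map_triples G" "N = map_equiv G `` {(x, y, z)}"
      by (rule ormaps_cases)
    then show ?thesis
      using frob_orbit_inj[of "lin R x"] by (simp add: lin_image_class card_image map_triples_iff)
  qed
  moreover have "card (primitive R) = totient (2 ^ e - 1)"
    using card_primitive_elements(1)[OF field_axioms finite_carrier]
    unfolding primitive_def card_carrier .
  ultimately show ?thesis by (simp add: mult.commute)
qed

lemma ormaps_nonempty: "ormaps G \<noteq> {}"
proof -
  have "primitive R \<noteq> {}"
    using card_primitive_elements(2)[OF field_axioms finite_carrier] unfolding primitive_def .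
  then show ?thesis by (metis map_triples_exI ormapsI all_not_in_conv)
qed

section \<open>Type, genus and chirality\<close>

lemma valency_eq:
  assumes "t \<in> map_triples G" shows "valency G t = 2 ^ e - 1"
  using assms by (cases t) (simp add: valency_def map_triples_iff ord_aff primitive_ord)

lemma primitive_inv: "a \<in> primitive R \<Longrightarrow> inv a \<in> primitive R"
  using M.ord_inv[of a] unfolding primitive_def by (auto simp: m_inv_mult_of inv_nonzero)

lemma dual_map_triples:
  assumes "(x, y, z) \<in> map_triples G"
  shows "dual G (x, y, z) \<in> map_triples G" "lin R z = inv (lin R x)"
  using assms by (auto simp: map_triples_iff dual_def primitive_inv)

text \<open>The faces of a map are the vertices of its dual, so the valency formula applies to the
  dual triple.\<close>

lemma face_size_eq:
  assumes "t \<in> map_triples G" shows "face_size G t = 2 ^ e - 1"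
proof -
  obtain x y z where t: "t = (x, y, z)" by (cases t)
  have "valency G (dual G t) = 2 ^ e - 1"
    using dual_map_triples(1) assms valency_eq t by blast
  then show ?thesis by (simp add: t valency_def face_size_def dual_def)
qed

text \<open>The commutator has linear part 1, so it is a translation and squares to 1. It is
  nontrivial, since \<open>x\<close> and \<open>y\<close> could commute only if the linear part of
  \<open>x\<close> were 1; its order 2 gives Petrie length 4.\<close>

lemma petrie_length_eq:
  assumes "t \<in> map_triples G" shows "petrie_length G t = 4"
proof -
  obtain x y z where t: "t = (x, y, z)" by (cases t)
  then obtain b where b: "b \<in> carrier R" "b \<noteq> \<zero>" "y = aff R \<one> b" "x \<in> carrier G"
    "lin R x \<in> primitive R"
    using assms by (auto simp: map_triples_iff)
  obtain a c where x: "a \<in> carrier R" "a \<noteq> \<zero>" "c \<in> carrier R" "x = aff R a c" using b(4) ..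
  have y: "y \<in> carrier G" using b by simp
  let ?w = "inv\<^bsub>G\<^esub> x \<otimes>\<^bsub>G\<^esub> inv\<^bsub>G\<^esub> y \<otimes>\<^bsub>G\<^esub> x \<otimes>\<^bsub>G\<^esub> y"
  have w: "?w \<in> carrier G" using b y by simp
  have "lin R ?w = \<one>" using b(4) y b(1,3) by (simp add: inv_nonzero)
  then have "?w \<otimes>\<^bsub>G\<^esub> ?w = \<one>\<^bsub>G\<^esub>" using w by (simp add: square_eq_one_iff)
  moreover have "?w \<noteq> \<one>\<^bsub>G\<^esub>"
  proof
    assume w1: "?w = \<one>\<^bsub>G\<^esub>"
    have "inv\<^bsub>G\<^esub> x \<otimes>\<^bsub>G\<^esub> inv\<^bsub>G\<^esub> y = inv\<^bsub>G\<^esub> (y \<otimes>\<^bsub>G\<^esub> x)" using b y by (simp add: G.inv_mult_group)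
    then have "inv\<^bsub>G\<^esub> (y \<otimes>\<^bsub>G\<^esub> x) \<otimes>\<^bsub>G\<^esub> (x \<otimes>\<^bsub>G\<^esub> y) = \<one>\<^bsub>G\<^esub>"
      using w1 b(4) y by (simp add: G.m_assoc)
    then have "x \<otimes>\<^bsub>G\<^esub> y = y \<otimes>\<^bsub>G\<^esub> x"
      using b(4) y by (metis G.inv_solve_left' G.m_closed G.one_closed G.r_one)
    then have "a \<otimes> b \<oplus> c = c \<oplus> b" using x b by (simp add: aff_eq_iff)
    then have "c \<oplus> a \<otimes> b = c \<oplus> b" using x b by (simp add: a_comm)
    then have "a \<otimes> b = \<one> \<otimes> b" using x b by simp
    then have "a = \<one>" using x b m_rcancel by (metis one_closed)
    then show False using x b primitive_not_one[of "lin R x"] by simp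
  qed
  ultimately have "G.ord ?w = 2" using w by (simp add: ord_eq_2_iff)
  then show ?thesis by (simp add: t petrie_length_def)
qed

lemma genus_eq:
  assumes "t \<in> map_triples G"
  shows "genus G t = (2 ^ e - 1) * (2 ^ e - 4) / 4"
proof -
  define Q :: real where "Q = 2 ^ e"
  have Q: "Q \<ge> 4" using four_le unfolding Q_def by (metis numeral_le_real_of_nat_iff of_nat_numeral of_nat_power)
  \<comment> \<open>The subtraction inside \<open>real\<close> is the truncated one on naturals,
    hence the appeal to \<open>four_le\<close>.\<close>
  have "real (2 ^ e - 1) = Q - 1" using four_le by (simp add: Q_def of_nat_diff)
  moreover from this have "real (order G) = (Q - 1) * Q"
    by (simp add: order_def card_AGL1 Q_def)
  ultimately have "genus G t = 1 - ((Q - 1) * Q / (Q - 1) - (Q - 1) * Q / 2 + (Q - 1) * Q / (Q - 1)) / 2"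
    using assms by (simp add: genus_def valency_eq face_size_eq)
  also have "(Q - 1) * Q / (Q - 1) = Q" using Q by simp
  also have "1 - (Q - (Q - 1) * Q / 2 + Q) / 2 = (Q - 1) * (Q - 4) / 4" by (simp add: field_simps)
  finally show ?thesis by (simp add: Q_def)
qed

text \<open>If the inverse of a is a^(2^k) with k < e, then 2^e - 1 divides 2^k + 1, which is at
  most 2^(e-1) + 1. This leaves only 2^(e-1) <= 2.\<close>

lemma regular_map_exponent:
  assumes t: "t \<in> map_triples G" and reg: "regular_map G t"
  shows "e = 2"
proof -
  obtain x y z where xyz: "t = (x, y, z)" by (cases t)
  then obtain \<alpha> where \<alpha>: "\<alpha> \<in> auto G" "\<alpha> x = inv\<^bsub>G\<^esub> x"
    using reg by (auto simp: regular_map_def inverting_autos_def)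
  have x: "x \<in> carrier G" "lin R x \<in> primitive R" using t by (auto simp: xyz map_triples_iff)
  then obtain k where k: "k < e" "inv (lin R x) = lin R x [^] ((2::nat) ^ k)"
    using lin_auto[OF \<alpha>(1) x] \<alpha>(2) by auto
  have "lin R x [^] Suc (2 ^ k) = inv (lin R x) \<otimes> lin R x" using k x by simp
  also have "\<dots> = \<one>" using x by (simp add: inv_nonzero)
  finally have "2 ^ e - 1 dvd Suc (2 ^ k)" using x primitive_pow_eq_one_iff by blast
  then have le: "2 ^ e - 1 \<le> Suc (2 ^ k)" by (rule dvd_imp_le) simp
  have "(2::nat) ^ k \<le> 2 ^ (e - 1)" using k by (intro power_increasing) auto
  moreover have "(2::nat) ^ e = 2 * 2 ^ (e - 1)" using e_ge_2 by (cases e) auto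
  ultimately have "(2::nat) ^ (e - 1) \<le> 2" using le by linarith
  then have "(2::nat) ^ (e - 1) \<le> 2 ^ 1" by simp
  then have "e - 1 \<le> 1" by (subst (asm) power_increasing_iff) auto
  then show "e = 2" using e_ge_2 by simp
qed

section \<open>Duality and hole operations on isomorphism classes\<close>

lemma hole_nat_map_triples:
  assumes "(x, y, z) \<in> map_triples G" "coprime n (2 ^ e - 1)"
  shows "hole G (int n) (x, y, z) \<in> map_triples G"
  using assms by (auto simp: map_triples_iff hole_def int_pow_int primitive_pow_iff)

text \<open>The exponent -1 is handled apart, as inversion, because \<open>lin_pow\<close> and
  \<open>primitive_pow_iff\<close> concern natural powers.\<close>

lemma hole_minus_one_map_triples:
  assumes "(x, y, z) \<in> map_triples G"
  shows "hole G (-1) (x, y, z) \<in> map_triples G"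
proof -
  have "x [^]\<^bsub>G\<^esub> (-1::int) = inv\<^bsub>G\<^esub> x"
    using assms by (simp add: map_triples_iff G.int_pow_neg)
  then show ?thesis using assms by (auto simp: map_triples_iff hole_def primitive_inv)
qed

lemma dual_image_class:
  "t \<in> map_triples G \<Longrightarrow> dual G ` (map_equiv G `` {t}) = map_equiv G `` {dual G t}"
  by (rule G.map_equiv_class_image) (auto intro: dual_map_triples G.dual_equivariant)

lemma hole_image_class:
  assumes "coprime n (2 ^ e - 1)" "t \<in> map_triples G"
  shows "hole G (int n) ` (map_equiv G `` {t}) = map_equiv G `` {hole G (int n) t}"
  using assms(2) by (rule G.map_equiv_class_image[rotated 2])
    (auto intro: hole_nat_map_triples[OF _ assms(1)] G.hole_equivariant)

lemma hole_minus_one_image_class: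
  "t \<in> map_triples G \<Longrightarrow> hole G (-1) ` (map_equiv G `` {t}) = map_equiv G `` {hole G (-1) t}"
  by (rule G.map_equiv_class_image) (auto intro: hole_minus_one_map_triples G.hole_equivariant)

text \<open>Since \<open>y\<close> has linear part 1, \<open>z\<close> and the inverse of
  \<open>x\<close> have the same linear part. The two triples are thus equivalent with the trivial
  Frobenius power.\<close>

lemma dual_eq_hole_minus_one:
  assumes "N \<in> ormaps G"
  shows "dual G ` N = hole G (-1) ` N"
proof -
  from assms obtain x y z where t: "(x, y, z) \<in> map_triples G" "N = map_equiv G `` {(x, y, z)}"
    by (rule ormaps_cases)
  have x: "x \<in> carrier G" and p: "lin R x \<in> primitive R" using t by (auto simp: map_triples_iff)
  have "x [^]\<^bsub>G\<^esub> (-1::int) = inv\<^bsub>G\<^esub> x" using x by (simp add: G.int_pow_neg)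
  then have "lin R (x [^]\<^bsub>G\<^esub> (-1::int)) = lin R z [^] ((2::nat) ^ 0)"
    using x p dual_map_triples(2)[OF t(1)] by (simp add: inv_nonzero)
  then have "map_equiv G `` {dual G (x, y, z)} = map_equiv G `` {hole G (-1) (x, y, z)}"
    using dual_map_triples(1)[OF t(1)] hole_minus_one_map_triples[OF t(1)]
    unfolding dual_def hole_def prod.case by (subst map_equiv_class_eq_iff) blast+
  then show ?thesis using t by (simp add: dual_image_class hole_minus_one_image_class)
qed

lemma hole_class_eq:
  assumes t: "(x, y, z) \<in> map_triples G" "(x', y', z') \<in> map_triples G"
    and n: "coprime n (2 ^ e - 1)" "lin R x' = lin R x [^] n"
  shows "hole G (int n) ` (map_equiv G `` {(x, y, z)}) = map_equiv G `` {(x', y', z')}"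
proof -
  have "lin R x' = lin R (x [^]\<^bsub>G\<^esub> int n) [^] ((2::nat) ^ 0)"
    using t n by (simp add: map_triples_iff int_pow_int)
  then have "map_equiv G `` {hole G (int n) (x, y, z)} = map_equiv G `` {(x', y', z')}"
    using hole_nat_map_triples[OF t(1) n(1)] t(2)
    unfolding hole_def prod.case by (subst map_equiv_class_eq_iff) blast+
  then show ?thesis using t n by (simp add: hole_image_class)
qed

text \<open>Squaring the linear part is the Frobenius map itself, so it stays within the orbit; 2 is
  admissible because the valency is odd.\<close>

lemma hole_two:
  assumes "N \<in> ormaps G"
  shows "hole G 2 ` N = N"
proof -
  from assms obtain x y z where t: "(x, y, z) \<in> map_triples G" "N = map_equiv G `` {(x, y, z)}"
    by (rule ormaps_cases)
  then have "lin R x \<in> primitive R" by (simp add: map_triples_iff)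
  then obtain x' y' z' where t': "(x', y', z') \<in> map_triples G" "lin R x' = lin R x [^] ((2::nat) ^ 1)"
    using map_triples_exI frob_primitive by metis
  have "N = map_equiv G `` {(x', y', z')}"
    using t t' map_equiv_class_eq_iff[OF t(1) t'(1)] by blast
  moreover have "hole G (int 2) ` N = map_equiv G `` {(x', y', z')}"
    unfolding t(2) using e_ge_2 t' by (intro hole_class_eq[OF t(1)]) auto
  ultimately show ?thesis by simp
qed

text \<open>Any two primitive elements are powers of each other, so any two maps are joined by a single
  hole operation.\<close>

lemma ormaps_arc:
  assumes N: "N \<in> ormaps G" "N' \<in> ormaps G" "N \<noteq> N'"
  shows "(N, N') \<in> parcs (ormaps_graph G)"
proof -
  from N(1) obtain x y z where t: "(x, y, z) \<in> map_triples G" "N = map_equiv G `` {(x, y, z)}"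
    by (rule ormaps_cases)
  from N(2) obtain x' y' z' where t': "(x', y', z') \<in> map_triples G" "N' = map_equiv G `` {(x', y', z')}"
    by (rule ormaps_cases)
  have p: "lin R x \<in> primitive R" "lin R x' \<in> primitive R" using t t' by (auto simp: map_triples_iff)
  then obtain n :: nat where n: "lin R x' = lin R x [^] n"
    using primitive_power[OF p(1), of "lin R x'"] by auto
  then have co: "coprime n (2 ^ e - 1)" using p primitive_pow_iff by metis
  have "s \<in> map_triples G" if "s \<in> N" for s using that t by (auto simp: map_equiv_def)
  moreover have "coprime (int n) (int (2 ^ e - 1))" using co by (simp only: coprime_int_iff)
  ultimately have "\<forall>s\<in>N. coprime (int n) (int (valency G s))"
    using valency_eq by metis
  moreover have "N' = hole G (int n) ` N"
    using hole_class_eq[OF t(1) t'(1) co n] t t' by simp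
  ultimately show ?thesis
    using N unfolding ormaps_graph_def pair_pre_digraph.select_convs by blast
qed

lemma ormaps_graph_connected: "Digraph_Component.connected (ormaps_graph G)"
  unfolding connected_def
proof (rule strongly_connectedI)
  \<comment> \<open>\<open>connected\<close> asks that the symmetric closure be strongly connected,
    which includes having at least one vertex.\<close>
  let ?S = "with_proj (mk_symmetric (with_proj (ormaps_graph G)))"
  have V: "verts ?S = ormaps G" by (simp add: ormaps_graph_def)
  show "verts ?S \<noteq> {}" using ormaps_nonempty V by simp
  fix u v assume uv: "u \<in> verts ?S" "v \<in> verts ?S"
  show "u \<rightarrow>\<^sup>*\<^bsub>?S\<^esub> v"
  proof (cases "u = v")
    case False
    then have "(u, v) \<in> parcs (ormaps_graph G)" using uv V by (intro ormaps_arc) auto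
    then have "(u, v) \<in> arcs_ends ?S" by (force simp: parcs_mk_symmetric)
    then show ?thesis unfolding reachable_def
      using uv by (blast intro: rtrancl_on_into_rtrancl_on rtrancl_on_refl)
  qed (use uv in \<open>auto simp: reachable_def\<close>)
qed

subsection \<open>The field with four elements\<close>

text \<open>Here \<open>a\<close> has order 3, and cancelling the factor 1 + a of a^3 + 1 gives a^2
  + a + 1 = 0. Inversion of \<open>a\<close> therefore coincides with the Frobenius map.\<close>

lemma quartic_unit:
  assumes e: "e = 2" and a: "a \<in> primitive R"
  shows "a \<otimes> (a \<otimes> a) = \<one>" "a \<otimes> a = \<one> \<oplus> a" "inv a = a \<otimes> a"
proof -
  have "a [^] (3::nat) = \<one>" using a by (simp add: primitive_pow_eq_one_iff e)
  then show cube: "a \<otimes> (a \<otimes> a) = \<one>" using a by (simp add: numeral_3_eq_3 m_assoc)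
  then show "inv a = a \<otimes> a" using a by (metis comm_inv_char m_closed primitive_closed)
  have "(\<one> \<oplus> a) \<otimes> (a \<otimes> a \<oplus> (\<one> \<oplus> a)) = a \<otimes> (a \<otimes> a) \<oplus> \<one> \<oplus> (a \<oplus> a) \<oplus> (a \<otimes> a \<oplus> a \<otimes> a)"
    using primitive_closed[OF a] by algebra
  also have "\<dots> = \<zero>" using a cube by simp
  finally have "(\<one> \<oplus> a) \<otimes> (a \<otimes> a \<oplus> (\<one> \<oplus> a)) = \<zero>" .
  moreover have "\<one> \<oplus> a \<noteq> \<zero>" using a by (metis add_eq_zero_iff one_closed primitive_closed primitive_not_one)
  ultimately have "a \<otimes> a \<oplus> (\<one> \<oplus> a) = \<zero>" using a integral by (metis a_closed m_closed one_closed primitive_closed)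
  then show "a \<otimes> a = \<one> \<oplus> a" using a by (simp add: add_eq_zero_iff)
qed

text \<open>The points are labelled so that \<open>1\<close> is the fixed point of \<open>x\<close>, \<open>2\<close> its image under \<open>y\<close>,
  and \<open>3\<close>, \<open>4\<close> the further images of \<open>2\<close> under \<open>x\<close>.\<close>

lemma tetrahedral_labelling:
  assumes e: "e = 2" and t: "(x, y, z) \<in> map_triples G"
  obtains \<beta> :: "nat \<Rightarrow> 'a" where "bij_betw \<beta> {1..4} (carrier R)"
    "x (\<beta> 1) = \<beta> 1" "x (\<beta> 2) = \<beta> 3" "x (\<beta> 3) = \<beta> 4" "x (\<beta> 4) = \<beta> 2"
    "y (\<beta> 1) = \<beta> 2" "y (\<beta> 2) = \<beta> 1" "y (\<beta> 3) = \<beta> 4" "y (\<beta> 4) = \<beta> 3"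
proof -
  obtain b where b: "b \<in> carrier R" "b \<noteq> \<zero>" "y = aff R \<one> b" "x \<in> carrier G"
    "lin R x \<in> primitive R"
    using t by (auto simp: map_triples_iff)
  obtain a c where x: "a \<in> carrier R" "a \<noteq> \<zero>" "c \<in> carrier R" "x = aff R a c" using b(4) ..
  have a: "a \<in> primitive R" "a \<noteq> \<one>" using b x by auto
  note aa = quartic_unit[OF e a(1)]
  have ia: "\<one> \<oplus> a \<noteq> \<zero>" using x(1) a(2) by (metis add_eq_zero_iff one_closed)
  \<comment> \<open>The fixed point of \<open>x\<close>, from (1 + a) p = c. With \<open>p\<close>
    as origin, \<open>x\<close> is multiplication by \<open>a\<close> and \<open>y\<close> is
    addition of \<open>b\<close>, as \<open>xf\<close> and \<open>yf\<close> state.\<close>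
  define p where "p = inv (\<one> \<oplus> a) \<otimes> c"
  have p: "p \<in> carrier R" using ia x by (simp add: p_def inv_nonzero)
  have "(\<one> \<oplus> a) \<otimes> p = c" using ia x inv_nonzero[of "\<one> \<oplus> a"] by (simp add: p_def flip: m_assoc)
  then have c: "c = p \<oplus> a \<otimes> p" using x p by (simp add: l_distr)
  define \<beta> where "\<beta> i = (if i = 1 then p else if i = 2 then p \<oplus> b else if i = 3 then p \<oplus> a \<otimes> b
    else p \<oplus> (a \<otimes> a) \<otimes> b)" for i :: nat
  have \<beta>: "\<beta> 1 = p" "\<beta> 2 = p \<oplus> b" "\<beta> 3 = p \<oplus> a \<otimes> b" "\<beta> 4 = p \<oplus> (a \<otimes> a) \<otimes> b"
    by (simp_all add: \<beta>_def)
  have xf: "x (p \<oplus> d) = p \<oplus> a \<otimes> d" if d: "d \<in> carrier R" for d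
  proof -
    have "a \<otimes> (p \<oplus> d) \<oplus> (p \<oplus> a \<otimes> p) = p \<oplus> a \<otimes> d \<oplus> (a \<otimes> p \<oplus> a \<otimes> p)"
      using x(1) p d by algebra
    then show ?thesis using x(1) p d unfolding x(4) c by (simp add: aff_def)
  qed
  have yf: "y (p \<oplus> d) = p \<oplus> (d \<oplus> b)" if d: "d \<in> carrier R" for d
    using b p d by (simp add: aff_def a_assoc)
  have "x p = p" using xf[of \<zero>] x p by simp
  moreover have "y p = p \<oplus> b" using yf[of \<zero>] p b by simp
  moreover have "y (p \<oplus> b) = p" using yf[of b] p b by simp
  moreover have "x (p \<oplus> (a \<otimes> a) \<otimes> b) = p \<oplus> b"
    using xf[of "(a \<otimes> a) \<otimes> b"] x b p aa(1) by (simp flip: m_assoc)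
  moreover have "x (p \<oplus> a \<otimes> b) = p \<oplus> (a \<otimes> a) \<otimes> b"
    using xf[of "a \<otimes> b"] x b p by (simp add: m_assoc)
  moreover have "x (p \<oplus> b) = p \<oplus> a \<otimes> b" using xf[of b] b by simp
  moreover have ab: "(a \<otimes> a) \<otimes> b = a \<otimes> b \<oplus> b" using aa(2) x b by (simp add: l_distr a_comm)
  moreover have "y (p \<oplus> a \<otimes> b) = p \<oplus> (a \<otimes> a) \<otimes> b"
    using yf[of "a \<otimes> b"] x b p ab by simp
  moreover have "y (p \<oplus> (a \<otimes> a) \<otimes> b) = p \<oplus> a \<otimes> b"
    using yf[of "(a \<otimes> a) \<otimes> b"] x b p ab by (simp add: a_assoc)
  moreover have "bij_betw \<beta> {1..4} (carrier R)"
  proof -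
    have I: "{1..4::nat} = {1, 2, 3, 4}" by auto
    have "a \<otimes> a \<noteq> \<one>" using x a square_one[of a] by blast
    moreover have "a \<otimes> a \<noteq> a" using x a(2) m_lcancel[of a a \<one>] by auto
    ultimately have ne: "a \<otimes> b \<noteq> b" "(a \<otimes> a) \<otimes> b \<noteq> b" "(a \<otimes> a) \<otimes> b \<noteq> a \<otimes> b" "a \<otimes> b \<noteq> \<zero>" "(a \<otimes> a) \<otimes> b \<noteq> \<zero>"
      using x b a(2) m_rcancel[of b a \<one>] m_rcancel[of b "a \<otimes> a" \<one>] m_rcancel[of b "a \<otimes> a" a]
      by (auto simp: integral_iff)
    have cl: "a \<otimes> b \<in> carrier R" "(a \<otimes> a) \<otimes> b \<in> carrier R" using x b by auto
    have p0: "p \<oplus> d \<noteq> p" if "d \<in> carrier R" "d \<noteq> \<zero>" for d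
      using that p add.l_cancel_one by blast
    have "inj_on \<beta> {1..4}"
      unfolding I using ne p0[OF b(1,2)] p0[OF cl(1) ne(4)] p0[OF cl(2) ne(5)] p b cl
      by (auto simp: \<beta> \<beta>(1)[unfolded One_nat_def] inj_on_def)
    moreover have "\<beta> ` {1..4} \<subseteq> carrier R" unfolding I using p b cl by (auto simp: \<beta> \<beta>(1)[unfolded One_nat_def])
    ultimately have "\<beta> ` {1..4} = carrier R"
      by (intro card_subset_eq) (auto simp: card_image card_carrier e)
    then show ?thesis using \<open>inj_on \<beta> {1..4}\<close> by (simp add: bij_betw_def)
  qed
  ultimately show ?thesis by (intro that[of \<beta>]) (simp_all only: \<beta>)
qed

text \<open>The labelling sends the generators to even permutations, so the image lies in
  \<open>alt_group 4\<close>; both groups have order 12, so it is everything.\<close>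

lemma tetrahedral_iso:
  assumes e: "e = 2" and t: "t \<in> map_triples G"
  shows "\<exists>h\<in>iso G (alt_group 4). apply_triple h t = tetrahedral_triple"
proof -
  obtain x y z where xyz: "t = (x, y, z)" by (cases t)
  then obtain \<beta> :: "nat \<Rightarrow> 'a" where \<beta>: "bij_betw \<beta> {1..4} (carrier R)"
    "x (\<beta> 1) = \<beta> 1" "x (\<beta> 2) = \<beta> 3" "x (\<beta> 3) = \<beta> 4" "x (\<beta> 4) = \<beta> 2"
    "y (\<beta> 1) = \<beta> 2" "y (\<beta> 2) = \<beta> 1" "y (\<beta> 3) = \<beta> 4" "y (\<beta> 4) = \<beta> 3"
    using tetrahedral_labelling e t by metis
  have c: "x \<in> carrier G" "y \<in> carrier G" "z \<in> carrier G" "generate G {x, y, z} = carrier G"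
    "x \<otimes>\<^bsub>G\<^esub> y \<otimes>\<^bsub>G\<^esub> z = \<one>\<^bsub>G\<^esub>"
    using t by (auto simp: map_triples_def xyz)
  let ?h = "relabel 4 \<beta>" and ?x = "cycle_of_list [2, 3, 4::nat]"
    and ?y = "transpose 1 (2::nat) \<circ> transpose 3 4"
  interpret S: group "sym_group 4" by (rule sym_group_is_group)
  interpret A: group "alt_group 4" by (rule alt_group_is_group)
  have I: "{1..4::nat} = {1, 2, 3, 4}" by auto
  have px: "?x permutes {1..4}" "?y permutes {1..4}"
    by (auto intro!: permutes_compose permutes_swap_id)
  have hx: "?h x = ?x"
  proof (rule relabel_eqI[OF \<beta>(1) px(1)])
    fix i :: nat assume "i \<in> {1..4}"
    then show "x (\<beta> i) = \<beta> (?x i)" using \<beta> unfolding I by (auto simp: transpose_def)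
  qed
  have hy: "?h y = ?y"
  proof (rule relabel_eqI[OF \<beta>(1) px(2)])
    fix i :: nat assume "i \<in> {1..4}"
    then show "y (\<beta> i) = \<beta> (?y i)" using \<beta> unfolding I by (auto simp: transpose_def)
  qed
  have h: "?h \<in> iso (BijGroup (carrier R)) (sym_group 4)" by (rule relabel_iso[OF \<beta>(1)])
  have sub: "carrier G \<subseteq> carrier (BijGroup (carrier R))" using AGL1_subgroup by (rule subgroup.subset)
  have mult: "monoid.mult G = monoid.mult (BijGroup (carrier R))" by (simp add: AGL1_def)
  have hom: "?h \<in> hom G (sym_group 4)" using h sub by (auto simp: iso_def hom_def mult)
  have inj: "inj_on ?h (carrier G)" using h sub by (auto simp: iso_def bij_betw_def intro: inj_on_subset)
  interpret h: group_hom G "sym_group 4" ?h using hom by unfold_locales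
  have xA: "?x \<in> carrier (alt_group 4)" "?y \<in> carrier (alt_group 4)"
    using px by (auto simp: alt_group_carrier evenperm_comp permutation_swap_id evenperm_swap permutation_compose)
  have "?h x \<otimes>\<^bsub>sym_group 4\<^esub> ?h y \<otimes>\<^bsub>sym_group 4\<^esub> ?h z = \<one>\<^bsub>sym_group 4\<^esub>"
    using c by (simp flip: h.hom_mult)
  then have hz1: "(?x \<circ> ?y) \<circ> ?h z = id" unfolding hx hy sym_group_mult sym_group_one .
  have xyA: "?x \<circ> ?y \<in> carrier (alt_group 4)" using A.m_closed[OF xA] by (simp add: alt_group_mult)
  have "?h z = ((inv\<^bsub>alt_group 4\<^esub> (?x \<circ> ?y)) \<circ> (?x \<circ> ?y)) \<circ> ?h z"
    using A.l_inv[OF xyA] by (simp add: alt_group_mult alt_group_one)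
  also have "\<dots> = inv\<^bsub>alt_group 4\<^esub> (?x \<circ> ?y)" using hz1 by (metis comp_assoc comp_id)
  finally have hz: "?h z = inv\<^bsub>alt_group 4\<^esub> (?x \<circ> ?y)" .
  have zA: "?h z \<in> carrier (alt_group 4)" unfolding hz using xyA by (rule A.inv_closed)
  have "{?h x, ?h y, ?h z} \<subseteq> carrier (alt_group 4)" using xA zA unfolding hx hy by blast
  then have "generate (sym_group 4) {?h x, ?h y, ?h z} \<subseteq> carrier (alt_group 4)"
    by (rule S.generate_subgroup_incl[OF _ alt_group_is_subgroup])
  moreover have "generate (sym_group 4) {?h x, ?h y, ?h z} = ?h ` carrier G"
    using h.generate_img[of "{x, y, z}"] c by simp
  ultimately have im: "?h ` carrier G \<subseteq> carrier (alt_group 4)" by simp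
  have "2 * card (carrier (alt_group 4)) = fact 4" by (rule alt_group_card_carrier) simp
  then have card: "card (carrier (alt_group 4)) = 12" by (simp add: fact_numeral)
  then have "finite (carrier (alt_group 4))" using card.infinite by fastforce
  then have "?h ` carrier G = carrier (alt_group 4)"
    using im inj card by (intro card_subset_eq) (auto simp: card_image card_AGL1 e)
  then have "?h \<in> iso G (alt_group 4)"
    using hom inj by (auto simp: iso_def hom_def bij_betw_def alt_group_mult sym_group_mult)
  moreover have "apply_triple ?h t = tetrahedral_triple"
    unfolding xyz apply_triple_simp hx hy hz tetrahedral_triple_def Let_def ..
  ultimately show ?thesis by blast
qed

text \<open>The transposition (3 4) is the reflection of the tetrahedron that fixes the arc from 1
  to 2. It is odd, inverts the rotation (2 3 4) and commutes with the half-turn, as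
  \<open>full_aut_is_iso\<close> requires.\<close>

lemma sym_group_full_aut:
  assumes e: "e = 2" and t: "t \<in> map_triples G"
  shows "sym_group 4 \<cong> full_aut G t"
proof -
  obtain x y z where xyz: "t = (x, y, z)" by (cases t)
  obtain h where h: "h \<in> iso G (alt_group 4)" "apply_triple h t = tetrahedral_triple"
    using tetrahedral_iso[OF assms] by blast
  then have hxy: "h x = cycle_of_list [2, 3, 4]" "h y = transpose 1 2 \<circ> transpose 3 4"
    by (auto simp: xyz tetrahedral_triple_def Let_def)
  let ?\<tau> = "transpose 3 (4::nat)"
  interpret S: group "sym_group 4" by (rule sym_group_is_group)
  have perm: "permutation p" if "p permutes {1..4::nat}" for p
    using that permutation_permutes by blast
  have \<tau>: "?\<tau> \<in> carrier (sym_group 4)" by (auto simp: sym_group_carrier intro!: permutes_swap_id)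
  have mem: "h x \<in> carrier (sym_group 4)" "h y \<in> carrier (sym_group 4)"
    unfolding hxy sym_group_carrier by (auto intro!: permutes_compose permutes_swap_id)
  have "sym_group 4 \<cong> full_aut G (x, y, z)"
  proof (rule full_aut_is_iso[where K = "carrier (alt_group 4)" and h = h and \<tau> = ?\<tau>])
    show "h \<in> iso G (sym_group 4\<lparr>carrier := carrier (alt_group 4)\<rparr>)"
      using h(1) by (simp add: alt_group_def)
    show "?\<tau> \<notin> carrier (alt_group 4)" by (simp add: alt_group_carrier evenperm_swap)
    show "?\<tau> \<otimes>\<^bsub>sym_group 4\<^esub> ?\<tau> = \<one>\<^bsub>sym_group 4\<^esub>" by (simp add: sym_group_mult sym_group_one)
    show "u \<otimes>\<^bsub>sym_group 4\<^esub> ?\<tau> \<in> carrier (alt_group 4)"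
      if "u \<in> carrier (sym_group 4)" "u \<notin> carrier (alt_group 4)" for u
      using that \<tau> perm
      by (auto simp: alt_group_carrier sym_group_carrier sym_group_mult evenperm_comp evenperm_swap
        permutation_swap_id intro!: permutes_compose)
    show "?\<tau> \<otimes>\<^bsub>sym_group 4\<^esub> h x \<otimes>\<^bsub>sym_group 4\<^esub> ?\<tau> = inv\<^bsub>sym_group 4\<^esub> h x"
    proof (rule S.inv_equality[symmetric])
      show "?\<tau> \<otimes>\<^bsub>sym_group 4\<^esub> h x \<otimes>\<^bsub>sym_group 4\<^esub> ?\<tau> \<otimes>\<^bsub>sym_group 4\<^esub> h x = \<one>\<^bsub>sym_group 4\<^esub>"
        unfolding hxy sym_group_mult sym_group_one by (auto simp: fun_eq_iff transpose_def)
    qed (use \<tau> mem in auto)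
    show "?\<tau> \<otimes>\<^bsub>sym_group 4\<^esub> h y \<otimes>\<^bsub>sym_group 4\<^esub> ?\<tau> = inv\<^bsub>sym_group 4\<^esub> h y"
    proof (rule S.inv_equality[symmetric])
      show "?\<tau> \<otimes>\<^bsub>sym_group 4\<^esub> h y \<otimes>\<^bsub>sym_group 4\<^esub> ?\<tau> \<otimes>\<^bsub>sym_group 4\<^esub> h y = \<one>\<^bsub>sym_group 4\<^esub>"
        unfolding hxy sym_group_mult sym_group_one by (auto simp: fun_eq_iff transpose_def)
    qed (use \<tau> mem in auto)
  qed (use t \<tau> xyz AGL1_group sym_group_is_group alt_group_is_subgroup in auto)
  then show ?thesis by (simp add: xyz)
qed

section \<open>The affine semilinear group and outer regularity over four elements\<close>

lemma prime_subfield_subset: "prime_subfield R \<subseteq> {\<zero>, \<one>}"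
proof -
  have "subfield {\<zero>, \<one>} R"
  proof (rule subfieldI')
    show "subring {\<zero>, \<one>} R" by (rule subringI) auto
  qed auto
  then show ?thesis unfolding prime_subfield_def by blast
qed

lemma frob_Gal: "(\<lambda>a\<in>carrier R. a [^] ((2::nat) ^ k)) \<in> carrier (Gal_prime R)" (is "?s \<in> _")
proof -
  have "inj_on ?s (carrier R)" using frob_inj[of k] by (simp add: inj_on_def)
  then have "bij_betw ?s (carrier R) (carrier R)"
    unfolding bij_betw_def by (intro conjI endo_inj_surj) auto
  moreover have "?s \<in> ring_hom R R"
    using frob_hom[of k] by (auto simp: ring_hom_def)
  moreover have "\<forall>c\<in>prime_subfield R. ?s c = c"
    using prime_subfield_subset by (auto simp: nat_pow_zero)
  ultimately show ?thesis by (simp add: Gal_prime_def Bij_def)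
qed

text \<open>The product \<open>(g, s) \<mapsto> g s\<close> is injective because \<open>s\<close> fixes \<open>0\<close> and \<open>1\<close>, and already the pairs
  with \<open>s\<close> a power of the Frobenius map give all permutations of a field with four elements.\<close>

lemma AGammaL1_iso_Bij:
  assumes e: "e = 2"
  shows "AGammaL1 R \<cong> BijGroup (carrier R)"
proof -
  let ?B = "BijGroup (carrier R)"
  interpret B: group ?B by (rule group_BijGroup)
  define f where "f = (\<lambda>(g, s). g \<otimes>\<^bsub>?B\<^esub> s)"
  have cB: "carrier ?B = Bij (carrier R)" by (simp add: BijGroup_def)
  have GB: "g \<in> carrier ?B" if "g \<in> carrier G" for g
    using that subgroup.subset[OF AGL1_subgroup] by blast
  have SB: "s \<in> carrier ?B" "s \<zero> = \<zero>" "s \<one> = \<one>" if "s \<in> carrier (Gal_prime R)" for s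
    using that ring_hom_zero[of s R R] ring_hom_one[of s R R] is_ring
    by (auto simp: Gal_prime_def BijGroup_def)
  have mult: "monoid.mult G = monoid.mult ?B" "monoid.mult (Gal_prime R) = monoid.mult ?B"
    by (simp_all add: AGL1_def Gal_prime_def)
  have carr: "carrier (AGammaL1 R) = carrier G \<times> carrier (Gal_prime R)"
    by (simp add: AGammaL1_def semidirect_def)
  have hom: "f \<in> hom (AGammaL1 R) ?B"
  proof (rule homI)
    fix u v assume "u \<in> carrier (AGammaL1 R)" "v \<in> carrier (AGammaL1 R)"
    then obtain g s g' s' where u: "u = (g, s)" "g \<in> carrier ?B" "s \<in> carrier ?B"
      and v: "v = (g', s')" "g' \<in> carrier ?B" "s' \<in> carrier ?B"
      using carr GB SB(1) by auto
    \<comment> \<open>The Galois group acts by conjugation inside the permutation group, so the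
      inner factors cancel and the product map is multiplicative.\<close>
    have "f (u \<otimes>\<^bsub>AGammaL1 R\<^esub> v) = g \<otimes>\<^bsub>?B\<^esub> (s \<otimes>\<^bsub>?B\<^esub> g' \<otimes>\<^bsub>?B\<^esub> inv\<^bsub>?B\<^esub> s) \<otimes>\<^bsub>?B\<^esub> (s \<otimes>\<^bsub>?B\<^esub> s')"
      using u v by (simp add: f_def AGammaL1_def semidirect_def mult)
    also have "\<dots> = g \<otimes>\<^bsub>?B\<^esub> s \<otimes>\<^bsub>?B\<^esub> g' \<otimes>\<^bsub>?B\<^esub> (inv\<^bsub>?B\<^esub> s \<otimes>\<^bsub>?B\<^esub> s) \<otimes>\<^bsub>?B\<^esub> s'"
      using u v by (simp only: B.m_assoc B.m_closed B.inv_closed)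
    also have "\<dots> = f u \<otimes>\<^bsub>?B\<^esub> f v" using u v by (simp add: f_def B.m_assoc)
    finally show "f (u \<otimes>\<^bsub>AGammaL1 R\<^esub> v) = f u \<otimes>\<^bsub>?B\<^esub> f v" .
  qed (use carr GB SB(1) in \<open>auto simp: f_def\<close>)
  have inj: "inj_on f (carrier (AGammaL1 R))"
  proof (rule inj_onI)
    fix u v assume uv: "u \<in> carrier (AGammaL1 R)" "v \<in> carrier (AGammaL1 R)" "f u = f v"
    then obtain g s g' s' where u: "u = (g, s)" "g \<in> carrier G" "s \<in> carrier (Gal_prime R)"
      and v: "v = (g', s')" "g' \<in> carrier G" "s' \<in> carrier (Gal_prime R)"
      unfolding carr by auto
    have eq: "g \<otimes>\<^bsub>?B\<^esub> s = g' \<otimes>\<^bsub>?B\<^esub> s'" using uv u v by (simp add: f_def)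
    have ev: "(k \<otimes>\<^bsub>?B\<^esub> r) i = k (r i)" if "k \<in> carrier ?B" "r \<in> carrier ?B" "i \<in> carrier R" for k r i
      using that by (simp add: BijGroup_def compose_eq)
    have "g \<zero> = g' \<zero>" "g \<one> = g' \<one>"
      using eq ev[of g s] ev[of g' s'] u v GB SB by (metis zero_closed, metis one_closed)
    moreover obtain a b where "a \<in> carrier R" "b \<in> carrier R" "g = aff R a b" using u(2) by blast
    moreover obtain a' b' where "a' \<in> carrier R" "b' \<in> carrier R" "g' = aff R a' b'" using v(2) by blast
    ultimately have "g = g'" by (metis lin_aff aff_zero lin_def)
    moreover from this have "s = s'" using eq u v GB SB(1) by simp
    ultimately show "u = v" using u v by simp
  qed
  have "card (carrier R) = card {1..4::nat}" by (simp add: card_carrier e)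
  then obtain \<beta> where "bij_betw \<beta> {1..4::nat} (carrier R)"
    using finite_same_card_bij[of "{1..4::nat}" "carrier R"] by auto
  from iso_same_card[OF is_isoI[OF relabel_iso[OF this]]]
  have cardB: "card (carrier ?B) = 24" by (simp add: sym_group_card_carrier fact_numeral)
  let ?F = "\<lambda>k. \<lambda>a\<in>carrier R. a [^] ((2::nat) ^ k)"
  let ?P = "carrier G \<times> {?F 0, ?F 1}"
  have "?F 0 \<noteq> ?F 1"
  proof
    assume eq: "?F 0 = ?F 1"
    obtain x y z where "(x, y, z) \<in> map_triples G" using ormaps_nonempty by (metis all_not_in_conv ormaps_cases)
    then have p: "lin R x \<in> primitive R" by (simp add: map_triples_iff)
    from fun_cong[OF eq, of "lin R x"] have "lin R x [^] ((2::nat) ^ 0) = lin R x [^] ((2::nat) ^ 1)"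
      using p by simp
    then have "(0::nat) = 1" by (rule inj_onD[OF frob_orbit_inj[OF p]]) (use e in auto)
    then show False by simp
  qed
  \<comment> \<open>Twelve affine maps and two Frobenius powers already account for all 4!
    permutations, so the order of \<open>Gal_prime R\<close> need not be known beforehand.\<close>
  then have cP: "card ?P = 24" by (simp add: card_cartesian_product card_AGL1 e)
  have P: "?P \<subseteq> carrier (AGammaL1 R)" unfolding carr using frob_Gal[of 0] frob_Gal[of 1] by blast
  have fin: "finite (carrier ?B)" using cardB card.infinite by fastforce
  have "f ` ?P \<subseteq> carrier ?B" using P hom by (auto simp: hom_def)
  moreover have "card (f ` ?P) = 24" using cP card_image[OF inj_on_subset[OF inj P]] by simp
  ultimately have "f ` ?P = carrier ?B" using fin cardB by (intro card_subset_eq) auto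
  moreover have "f ` carrier (AGammaL1 R) \<subseteq> carrier ?B" using hom by (auto simp: hom_def)
  ultimately have "f ` carrier (AGammaL1 R) = carrier ?B" using P by blast
  then have "f \<in> iso (AGammaL1 R) ?B" using hom inj by (simp add: iso_def bij_betw_def)
  then show ?thesis by (rule is_isoI)
qed

text \<open>A field automorphism s conjugates t -> a t + b into t -> s(a) t + s(b), so it normalises
  the affine group. This closure is what reversing the isomorphism with \<open>sym_group 4\<close>
  relies on.\<close>

lemma AGammaL1_closed:
  assumes "u \<in> carrier (AGammaL1 R)" "v \<in> carrier (AGammaL1 R)"
  shows "u \<otimes>\<^bsub>AGammaL1 R\<^esub> v \<in> carrier (AGammaL1 R)"
proof -
  let ?B = "BijGroup (carrier R)" and ?L = "carrier (Gal_prime R)"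
  interpret B: group ?B by (rule group_BijGroup)
  obtain g s g' s' where u: "u = (g, s)" "g \<in> carrier G" "s \<in> ?L"
    and v: "v = (g', s')" "g' \<in> carrier G" "s' \<in> ?L"
    using assms by (auto simp: AGammaL1_def semidirect_def)
  have s: "s \<in> Bij (carrier R)" "s \<in> ring_hom R R" "s' \<in> Bij (carrier R)" "s' \<in> ring_hom R R"
    and fixes_prime: "\<And>c. c \<in> prime_subfield R \<Longrightarrow> s c = c \<and> s' c = c"
    using u v by (auto simp: Gal_prime_def)
  have "compose (carrier R) s s' \<in> ring_hom R R"
    using s ring_hom_closed[OF s(4)] by (intro ring_hom_memI)
      (auto simp: compose_eq ring_hom_closed ring_hom_add ring_hom_mult ring_hom_one)
  moreover have "compose (carrier R) s s' c = c" if "c \<in> prime_subfield R" for c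
    using that fixes_prime[OF that] prime_subfield_subset by (auto simp: compose_def)
  ultimately have "s \<otimes>\<^bsub>Gal_prime R\<^esub> s' \<in> ?L"
    using s by (simp add: Gal_prime_def BijGroup_def compose_Bij)
  moreover have "s \<otimes>\<^bsub>?B\<^esub> g' \<otimes>\<^bsub>?B\<^esub> inv\<^bsub>?B\<^esub> s \<in> carrier G"
  proof -
    obtain a b where g': "a \<in> carrier R" "a \<noteq> \<zero>" "b \<in> carrier R" "g' = aff R a b" using v(2) ..
    have "s \<zero> = \<zero>" using s ring_hom_zero[of s R R] is_ring by simp
    then have "s a \<noteq> \<zero>" using s(1) g' by (metis Bij_def Int_iff bij_betw_def inj_onD mem_Collect_eq zero_closed)
    then have w: "aff R (s a) (s b) \<in> carrier G" using g' s by (auto simp: ring_hom_closed)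
    have wB: "aff R (s a) (s b) \<in> carrier ?B" using w subgroup.subset[OF AGL1_subgroup] by blast
    have sB: "s \<in> carrier ?B" using s(1) by (simp add: BijGroup_def)
    have "compose (carrier R) s g' = compose (carrier R) (aff R (s a) (s b)) s"
      using g' ring_hom_closed[OF s(2)] ring_hom_add[OF s(2)] ring_hom_mult[OF s(2)]
      by (auto simp: compose_def restrict_def fun_eq_iff aff_def)
    then have "s \<otimes>\<^bsub>?B\<^esub> g' = aff R (s a) (s b) \<otimes>\<^bsub>?B\<^esub> s"
      using s w v(2) subgroup.subset[OF AGL1_subgroup] by (auto simp: BijGroup_def)
    then have "s \<otimes>\<^bsub>?B\<^esub> g' \<otimes>\<^bsub>?B\<^esub> inv\<^bsub>?B\<^esub> s = aff R (s a) (s b)"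
      using sB wB by (simp add: B.m_assoc)
    then show ?thesis using w by simp
  qed
  ultimately show ?thesis
    using u v G.m_closed by (simp add: AGammaL1_def semidirect_def)
qed

lemma AGammaL1_iso_sym_group:
  assumes e: "e = 2"
  shows "AGammaL1 R \<cong> sym_group 4" "sym_group 4 \<cong> AGammaL1 R"
proof -
  have "card (carrier R) = card {1..4::nat}" by (simp add: card_carrier e)
  then obtain \<beta> where "bij_betw \<beta> {1..4::nat} (carrier R)"
    using finite_same_card_bij[of "{1..4::nat}" "carrier R"] by auto
  then have "BijGroup (carrier R) \<cong> sym_group 4" by (rule is_isoI[OF relabel_iso])
  with AGammaL1_iso_Bij[OF e] show iso: "AGammaL1 R \<cong> sym_group 4" by (rule iso_trans)
  then obtain f where "f \<in> iso (AGammaL1 R) (sym_group 4)" by (auto simp: is_iso_def)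
  then show "sym_group 4 \<cong> AGammaL1 R"
    by (rule iso_sym_if_closed)
      (auto intro: AGammaL1_closed monoid.m_closed group.is_monoid[OF sym_group_is_group])
qed

text \<open>Inversion of the linear part is here the Frobenius map, which yields the inverting
  automorphism. Inner automorphisms preserve linear parts, since these commute, whereas this one
  changes a to a^2, which differs from a.\<close>

lemma outer_regular_quartic:
  assumes e: "e = 2" and t: "t \<in> map_triples G"
  shows "outer_regular G t"
proof -
  obtain x y z where xyz: "t = (x, y, z)" by (cases t)
  then have x: "x \<in> carrier G" "y \<in> carrier G" "lin R x \<in> primitive R" "lin R y = \<one>"
    using t by (auto simp: map_triples_iff)
  have "y \<otimes>\<^bsub>G\<^esub> y = \<one>\<^bsub>G\<^esub>" using x by (simp add: square_eq_one_iff)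
  then have inv_y: "inv\<^bsub>G\<^esub> y = y" using x by (simp add: G.inv_equality)
  have inv_x: "x [^]\<^bsub>G\<^esub> (-1::int) = inv\<^bsub>G\<^esub> x" using x by (simp add: G.int_pow_neg)
  let ?t' = "(inv\<^bsub>G\<^esub> x, y, inv\<^bsub>G\<^esub> (inv\<^bsub>G\<^esub> x \<otimes>\<^bsub>G\<^esub> y))"
  have t': "?t' \<in> map_triples G"
    using hole_minus_one_map_triples[of x y z] t by (simp add: hole_def inv_x xyz)
  have inv_lin: "inv (lin R x) = lin R x [^] ((2::nat) ^ 1)"
    using quartic_unit(3)[OF e x(3)] x by (simp add: numeral_2_eq_2)
  then have "lin R (inv\<^bsub>G\<^esub> x) = lin R x [^] ((2::nat) ^ 1)" using x by simp
  then obtain \<alpha> where \<alpha>: "\<alpha> \<in> auto G" "?t' = apply_triple \<alpha> (x, y, z)"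
    using semi_conj_triple[OF frob_hom frob_inj, of x y z] t t' xyz by blast
  then have "\<alpha> \<in> inverting_autos G t" by (simp add: inverting_autos_def xyz inv_y)
  moreover have "\<alpha> \<notin> inner_auto G"
  proof
    assume "\<alpha> \<in> inner_auto G"
    then obtain g where "g \<in> carrier G" "\<alpha> x = g \<otimes>\<^bsub>G\<^esub> x \<otimes>\<^bsub>G\<^esub> inv\<^bsub>G\<^esub> g"
      using x by (auto simp: inner_auto_def)
    then have "lin R (\<alpha> x) = lin R g \<otimes> lin R x \<otimes> inv (lin R g)" using x by simp
    also have "\<dots> = lin R x \<otimes> (lin R g \<otimes> inv (lin R g))"
      using x \<open>g \<in> carrier G\<close> inv_nonzero(1)[of "lin R g"]
        m_assoc[of "lin R x" "lin R g" "inv (lin R g)"] m_comm[of "lin R x" "lin R g"] by simp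
    also have "\<dots> = lin R x [^] ((2::nat) ^ 0)" using x \<open>g \<in> carrier G\<close> by (simp add: inv_nonzero)
    finally have "lin R x [^] ((2::nat) ^ 1) = lin R x [^] ((2::nat) ^ 0)"
      using lin_inv[OF x(1)] inv_lin \<alpha>(2) by simp
    then have "(1::nat) = 0" by (rule inj_onD[OF frob_orbit_inj[OF x(3)]]) (use e in auto)
    then show False by simp
  qed
  ultimately show ?thesis unfolding outer_regular_def by blast
qed

end

theorem theorem10p1:
  fixes R :: "('a, 'b) ring_scheme" and e q :: nat
  assumes "field R" and "e \<ge> 2" and "q = 2 ^ e" and "card (carrier R) = q"
  shows
    "(e > 2 \<longrightarrow>
       real (card (ormaps (AGL1 R))) = real (totient (q - 1)) / real e \<and>
       (\<forall>M\<in>ormaps (AGL1 R).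
          (\<forall>t\<in>M. extended_type (AGL1 R) t = (q - 1, q - 1, 4) \<and>
                 genus (AGL1 R) t = (real q - 1) * (real q - 4) / 4 \<and>
                 chiral (AGL1 R) t) \<and>
          dual (AGL1 R) ` M = hole (AGL1 R) (-1) ` M \<and>
          hole (AGL1 R) 2 ` M = M)) \<and>
     (e = 2 \<longrightarrow>
       (\<exists>M. ormaps (AGL1 R) = {M} \<and>
          (\<forall>t\<in>M. (\<exists>h\<in>iso (AGL1 R) (alt_group 4). apply_triple h t = tetrahedral_triple) \<and>
                 face_size (AGL1 R) t = 3 \<and> valency (AGL1 R) t = 3 \<and>
                 genus (AGL1 R) t = 0 \<and>
                 outer_regular (AGL1 R) t \<and>
                 full_aut (AGL1 R) t \<cong> AGammaL1 R)) \<and>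
       AGammaL1 R \<cong> sym_group 4) \<and>
     Digraph_Component.connected (ormaps_graph (AGL1 R))"
proof -
  interpret binary_field R e
    using assms by (simp add: binary_field_def binary_field_axioms_def)
  have q: "q = 2 ^ e" by fact
  have triples: "t \<in> map_triples (AGL1 R)" if "N \<in> ormaps (AGL1 R)" "t \<in> N" for N t
    using that by (auto elim!: ormaps_cases simp: map_equiv_def)
  show ?thesis
  proof (intro conjI impI ballI)
    have "real e * real (card (ormaps (AGL1 R))) = real (totient (q - 1))"
      using card_ormaps unfolding q by (metis of_nat_mult)
    then show "real (card (ormaps (AGL1 R))) = real (totient (q - 1)) / real e"
      using assms(2) by (simp add: field_simps)
  next
    fix N t assume "e > 2" "N \<in> ormaps (AGL1 R)" "t \<in> N"
    then have t: "t \<in> map_triples (AGL1 R)" by (auto intro: triples)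
    show "extended_type (AGL1 R) t = (q - 1, q - 1, 4)"
      unfolding extended_type_def valency_eq[OF t] face_size_eq[OF t] petrie_length_eq[OF t] q ..
    show "genus (AGL1 R) t = (real q - 1) * (real q - 4) / 4"
      using genus_eq[OF t] by (simp add: q)
    show "chiral (AGL1 R) t"
      using regular_map_exponent[OF t] \<open>e > 2\<close> by (auto simp: chiral_def)
  next
    assume e: "e = 2"
    \<comment> \<open>For e = 2 the count reads 2 * card = totient 3 = 2.\<close>
    have "card (ormaps (AGL1 R)) = 1"
      using card_ormaps totient_prime[of "3::nat"] by (simp add: e)
    then obtain N where N: "ormaps (AGL1 R) = {N}" by (rule card_1_singletonE)
    have "\<forall>t\<in>N. (\<exists>h\<in>iso (AGL1 R) (alt_group 4). apply_triple h t = tetrahedral_triple) \<and>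
                 face_size (AGL1 R) t = 3 \<and> valency (AGL1 R) t = 3 \<and>
                 genus (AGL1 R) t = 0 \<and>
                 outer_regular (AGL1 R) t \<and>
                 full_aut (AGL1 R) t \<cong> AGammaL1 R"
    proof
      fix t assume "t \<in> N"
      then have t: "t \<in> map_triples (AGL1 R)" using triples N by blast
      have "full_aut (AGL1 R) t \<cong> sym_group 4"
        using sym_group_full_aut[OF e t] by (rule group.iso_sym[OF sym_group_is_group])
      moreover have "sym_group 4 \<cong> AGammaL1 R"
        by (rule AGammaL1_iso_sym_group(2)[OF e])
      ultimately have "full_aut (AGL1 R) t \<cong> AGammaL1 R" by (rule iso_trans)
      then show "(\<exists>h\<in>iso (AGL1 R) (alt_group 4). apply_triple h t = tetrahedral_triple) \<and>
                 face_size (AGL1 R) t = 3 \<and> valency (AGL1 R) t = 3 \<and>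
                 genus (AGL1 R) t = 0 \<and>
                 outer_regular (AGL1 R) t \<and>
                 full_aut (AGL1 R) t \<cong> AGammaL1 R"
        using tetrahedral_iso[OF e t] face_size_eq[OF t] valency_eq[OF t] genus_eq[OF t]
          outer_regular_quartic[OF e t] by (simp add: e)
    qed
    with N show "\<exists>M. ormaps (AGL1 R) = {M} \<and>
          (\<forall>t\<in>M. (\<exists>h\<in>iso (AGL1 R) (alt_group 4). apply_triple h t = tetrahedral_triple) \<and>
                 face_size (AGL1 R) t = 3 \<and> valency (AGL1 R) t = 3 \<and>
                 genus (AGL1 R) t = 0 \<and>
                 outer_regular (AGL1 R) t \<and>
                 full_aut (AGL1 R) t \<cong> AGammaL1 R)"
      by blast
  qed (simp_all add: dual_eq_hole_minus_one hole_two ormaps_graph_connected AGammaL1_iso_sym_group)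
qed

end
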